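(* Let $G$ be a $2$-tree-connected graph, let $X\subseteq V(G)$ be an independent set, and let $f$ be a positive integer-valued function on $X$. Suppose that for every $S\subseteq X$, either $G$ has a spanning closed trail meeting each $v\in S$ at most $f(v)$ times, or $$\tfrac{1}{2}\Omega_2(G\setminus S)\le \sum_{v\in S}\big(f(v)-\tfrac{1}{2}\big)+1.$$ Then $G$ has a spanning closed trail meeting each $v\in X$ at most $f(v)$ times.
   Context: Graphs are finite, loopless, and may have multiple edges. A graph is $m$-tree-connected if it contains $m$ pairwise edge-disjoint spanning trees (a one-vertex graph is $m$-tree-connected). The $m$-tree-connected components are the maximal induced $m$-tree-connected subgraphs; their vertex sets partition the vertex set. For a partition $P$ of $V(H)$, $e_H(P)$ is the number of edges with ends in different parts; $\Omega_m(H)=m|P|-e_H(P)$ for $P$ the partition into vertex sets of the $m$-tree-connected components ($\Omega_m=0$ for the graph with no vertices). $G\setminus S$ is obtained by deleting $S$. A set is independent if no edge joins two of its vertices. A spanning closed trail is a closed trail (no repeated edges) passing through all vertices; it meets a vertex $v$ at most $f(v)$ times if it passes through $v$ at most $f(v)$ times. *)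

theory Defs
  imports Complex_Main "HOL-Library.Disjoint_Sets"
begin

text \<open>Edges are named objects, so that parallel edges are distinct edges with the same set of ends.\<close>

record ('v, 'e) mgraph =
  verts :: "'v set"
  edges :: "'e set"
  ends :: "'e \<Rightarrow> 'v set"

definition multigraph :: "('v, 'e) mgraph \<Rightarrow> bool" where
  "multigraph G \<longleftrightarrow> finite (verts G) \<and> finite (edges G) \<and>
     (\<forall>e\<in>edges G. ends G e \<subseteq> verts G \<and> card (ends G e) = 2)"

definition induced_subgraph :: "('v, 'e) mgraph \<Rightarrow> 'v set \<Rightarrow> ('v, 'e) mgraph" where
  "induced_subgraph G W =
     \<lparr>verts = W, edges = {e \<in> edges G. ends G e \<subseteq> W}, ends = ends G\<rparr>"

definition delete_verts :: "('v, 'e) mgraph \<Rightarrow> 'v set \<Rightarrow> ('v, 'e) mgraph" where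
  "delete_verts G S = induced_subgraph G (verts G - S)"

definition spanning_subgraph :: "('v, 'e) mgraph \<Rightarrow> 'e set \<Rightarrow> ('v, 'e) mgraph" where
  "spanning_subgraph G F = G\<lparr>edges := F\<rparr>"

definition independent_set :: "('v, 'e) mgraph \<Rightarrow> 'v set \<Rightarrow> bool" where
  "independent_set G X \<longleftrightarrow> X \<subseteq> verts G \<and> (\<forall>u\<in>X. \<forall>v\<in>X. \<forall>e\<in>edges G. ends G e \<noteq> {u, v})"

text \<open>The walk \<open>v\<^sub>0 e\<^sub>0 v\<^sub>1 \<dots> e\<^sub>n\<^sub>-\<^sub>1 v\<^sub>n\<close> is given by its list of \<open>n + 1\<close> vertices and its
  list of \<open>n\<close> edges; \<open>n = 0\<close> is allowed.\<close>

definition walk :: "('v, 'e) mgraph \<Rightarrow> 'v list \<Rightarrow> 'e list \<Rightarrow> bool" where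
  "walk G vs es \<longleftrightarrow> length vs = Suc (length es) \<and> set vs \<subseteq> verts G \<and> set es \<subseteq> edges G \<and>
     (\<forall>i<length es. ends G (es ! i) = {vs ! i, vs ! Suc i})"

definition closed_trail :: "('v, 'e) mgraph \<Rightarrow> 'v list \<Rightarrow> 'e list \<Rightarrow> bool" where
  "closed_trail G vs es \<longleftrightarrow> walk G vs es \<and> distinct es \<and> hd vs = last vs"

definition spanning_closed_trail :: "('v, 'e) mgraph \<Rightarrow> 'v list \<Rightarrow> 'e list \<Rightarrow> bool" where
  "spanning_closed_trail G vs es \<longleftrightarrow> closed_trail G vs es \<and> set vs = verts G"

text \<open>The first and the last entry of \<open>vs\<close> are the same passage of a closed trail, hence the \<open>tl\<close>.
  The one-vertex trail, which has no edges, passes once through its vertex.\<close>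

definition passes :: "'v list \<Rightarrow> 'v \<Rightarrow> nat" where
  "passes vs v = (if length vs = 1 then count_list vs v else count_list (tl vs) v)"

definition has_bounded_spanning_closed_trail ::
    "('v, 'e) mgraph \<Rightarrow> 'v set \<Rightarrow> ('v \<Rightarrow> nat) \<Rightarrow> bool" where
  "has_bounded_spanning_closed_trail G S f \<longleftrightarrow>
     (\<exists>vs es. spanning_closed_trail G vs es \<and> (\<forall>v\<in>S. passes vs v \<le> f v))"

definition connected_graph :: "('v, 'e) mgraph \<Rightarrow> bool" where
  "connected_graph G \<longleftrightarrow> verts G \<noteq> {} \<and>
     (\<forall>u\<in>verts G. \<forall>v\<in>verts G. \<exists>vs es. walk G vs es \<and> hd vs = u \<and> last vs = v)"

text \<open>Two parallel edges form a cycle of length two.\<close>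

definition cycle :: "('v, 'e) mgraph \<Rightarrow> 'v list \<Rightarrow> 'e list \<Rightarrow> bool" where
  "cycle G vs es \<longleftrightarrow> closed_trail G vs es \<and> es \<noteq> [] \<and> distinct (tl vs)"

definition tree :: "('v, 'e) mgraph \<Rightarrow> bool" where
  "tree G \<longleftrightarrow> connected_graph G \<and> (\<nexists>vs es. cycle G vs es)"

definition spanning_tree :: "('v, 'e) mgraph \<Rightarrow> 'e set \<Rightarrow> bool" where
  "spanning_tree G T \<longleftrightarrow> T \<subseteq> edges G \<and> tree (spanning_subgraph G T)"

text \<open>In a one-vertex graph the empty edge set is a spanning tree, and it is disjoint from itself;
  such a graph is therefore \<open>m\<close>-tree-connected for every \<open>m\<close>. The graph with no vertices is
  \<open>m\<close>-tree-connected for no \<open>m\<close>.\<close>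

definition tree_connected :: "nat \<Rightarrow> ('v, 'e) mgraph \<Rightarrow> bool" where
  "tree_connected m G \<longleftrightarrow> verts G \<noteq> {} \<and>
     (\<exists>T :: nat \<Rightarrow> 'e set. (\<forall>i<m. spanning_tree G (T i)) \<and> disjoint_family_on T {..<m})"

definition tree_connected_components :: "nat \<Rightarrow> ('v, 'e) mgraph \<Rightarrow> 'v set set" where
  "tree_connected_components m G =
     {W. W \<subseteq> verts G \<and> tree_connected m (induced_subgraph G W) \<and>
         (\<forall>W'. W \<subset> W' \<and> W' \<subseteq> verts G \<longrightarrow> \<not> tree_connected m (induced_subgraph G W'))}"

definition crossing_edges :: "('v, 'e) mgraph \<Rightarrow> 'v set set \<Rightarrow> 'e set" where
  "crossing_edges G P =
     {e \<in> edges G. \<exists>A\<in>P. \<exists>B\<in>P. A \<noteq> B \<and> ends G e \<inter> A \<noteq> {} \<and> ends G e \<inter> B \<noteq> {}}"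

text \<open>For the graph with no vertices the set of components is empty and \<open>Omega\<close> is \<open>0\<close>.\<close>

definition Omega :: "nat \<Rightarrow> ('v, 'e) mgraph \<Rightarrow> int" where
  "Omega m G = (let P = tree_connected_components m G
     in int m * int (card P) - int (card (crossing_edges G P)))"

end

theory Submission imports Defs begin

text \<open>The degree bound \<open>2 f v + 1\<close> suffices: two edge-disjoint spanning trees whose union meets it
  contain a connected spanning even subgraph (one tree plus a parity-correcting subset of the other),
  and parity improves the bound to \<open>2 f v\<close>. As \<open>X\<close> is independent, the bounds define a partition
  matroid, so matroid intersection yields two disjoint forests \<open>F 0\<close>, \<open>F 1\<close> respecting them, and a dual
  edge set \<open>A\<close>: both forests span \<open>A\<close>, and outside \<open>A\<close> they contain every edge of the graph except
  edges at the set \<open>T \<subseteq> X\<close> of vertices whose bound is exhausted there. If the inequality holds at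
  \<open>T\<close>, counting shows that \<open>F 0\<close> and \<open>F 1\<close> are spanning trees. Otherwise there is a closed trail for
  \<open>T\<close>; replacing its part inside \<open>A\<close> by \<open>F 0 \<inter> A\<close> and a parity correction from \<open>F 1 \<inter> A\<close> changes
  nothing at \<open>T\<close>, since \<open>A\<close> avoids \<open>T\<close>, and uses only edges of the forests at the rest of \<open>X\<close>.\<close>

section \<open>Matroid intersection\<close>

text \<open>The bound 2 f v + 1 and the 1/2 in the hypothesis belong together. A vertex v of T
  accounts for 2 f v + 1 forest edges outside A, while deleting it lowers 2 |V| by 2; the balance 2
  f v - 1 is twice the summand f v - 1/2. The remaining + 1, doubled, is the 2 by which two spanning
  trees fall short of 2 |V| edges. An even bound 2 f v would lose one edge per vertex of T in this
  count. The set S at which the hypothesis is tested cannot be guessed in advance. It is read off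
  from the min-max equality, which is tight in every class and for each forest separately. Two
  matroids suffice because disjointness of the forests and the degree bounds are expressed by a
  single matroid on two copies of the edge set.\<close>

definition rank_function :: "'a set \<Rightarrow> ('a set \<Rightarrow> nat) \<Rightarrow> bool" where
  "rank_function E r \<longleftrightarrow> finite E \<and> (\<forall>A\<subseteq>E. r A \<le> card A) \<and>
     (\<forall>B\<subseteq>E. \<forall>A\<subseteq>B. r A \<le> r B) \<and>
     (\<forall>A\<subseteq>E. \<forall>B\<subseteq>E. r (A \<union> B) + r (A \<inter> B) \<le> r A + r B)"

lemma rank_functionD:
  assumes "rank_function E r"
  shows "finite E" "A \<subseteq> E \<Longrightarrow> r A \<le> card A" "A \<subseteq> B \<Longrightarrow> B \<subseteq> E \<Longrightarrow> r A \<le> r B"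
    "A \<subseteq> E \<Longrightarrow> B \<subseteq> E \<Longrightarrow> r (A \<union> B) + r (A \<inter> B) \<le> r A + r B"
  using assms unfolding rank_function_def by auto

lemma rank_function_empty: "rank_function E r \<Longrightarrow> r {} = 0"
  using rank_functionD(2)[of E r "{}"] by simp

lemma rank_function_Un_le:
  assumes "rank_function E r" "A \<subseteq> E" "B \<subseteq> E"
  shows "r (A \<union> B) \<le> r A + r B"
  using rank_functionD(4)[OF assms] by simp

lemma rank_function_le_diff:
  assumes "rank_function E r" "A \<subseteq> E" "B \<subseteq> E"
  shows "r B \<le> r A + card (B - A)"
proof -
  have "r B \<le> r (A \<union> (B - A))"
    by (rule rank_functionD(3)[OF assms(1)]) (use assms in auto)
  also have "\<dots> \<le> r A + r (B - A)"
    by (rule rank_function_Un_le[OF assms(1)]) (use assms in auto)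
  also have "r (B - A) \<le> card (B - A)"
    by (rule rank_functionD(2)[OF assms(1)]) (use assms in auto)
  finally show ?thesis by simp
qed

text \<open>Independence of \<open>I\<close> is the equation \<open>r I = card I\<close>. Dropping
  \<open>I - J\<close> lowers the rank by at most its size, so no subset can fall short.\<close>

lemma rank_function_independent_subset:
  assumes "rank_function E r" "I \<subseteq> E" "r I = card I" "J \<subseteq> I"
  shows "r J = card J"
proof -
  have "card I \<le> r J + card (I - J)"
    using rank_function_le_diff[OF assms(1), of J I] assms by auto
  moreover have "card I = card J + card (I - J)"
    using assms rank_functionD(1)[OF assms(1)]
    by (metis card_Diff_subset card_mono finite_subset le_add_diff_inverse)
  moreover have "r J \<le> card J"
    using rank_functionD(2)[OF assms(1)] assms by auto
  ultimately show ?thesis by simp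
qed

lemma rank_function_loops:
  assumes "rank_function E r" "A \<subseteq> E" "\<And>e. e \<in> A \<Longrightarrow> r {e} = 0"
  shows "r A = 0"
proof -
  have "finite A" using assms rank_functionD(1) finite_subset by blast
  then show ?thesis using assms(2,3)
  proof (induction A)
    case empty
    then show ?case using rank_function_empty[OF assms(1)] by simp
  next
    case (insert x F)
    then show ?case using rank_function_Un_le[OF assms(1), of "{x}" F] by simp
  qed
qed

text \<open>\<open>spans A e\<close> stands for \<open>e\<close> lying in the closure of
  \<open>A\<close>. Unit steps controlled by a predicate that can only become true as
  \<open>A\<close> grows are diminishing returns, and these give submodularity.\<close>

lemma rank_functionI:
  assumes fin: "finite E" and empty: "r {} = 0"
    and step: "\<And>A e. A \<subseteq> E \<Longrightarrow> e \<in> E \<Longrightarrow> r (insert e A) = r A + (if spans A e then 0 else 1)"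
    and mono: "\<And>A B e. A \<subseteq> B \<Longrightarrow> B \<subseteq> E \<Longrightarrow> e \<in> E \<Longrightarrow> spans A e \<Longrightarrow> spans B e"
  shows "rank_function E r"
proof -
  \<comment> \<open>One induction for three facts: adding \<open>C\<close> raises the value over
    \<open>B\<close> by no more than over \<open>A\<close>, and over \<open>A\<close> by something
    between 0 and \<open>card C\<close>.\<close>
  have diff: "r (B \<union> C) + r A \<le> r (A \<union> C) + r B \<and> r A \<le> r (A \<union> C) \<and> r (A \<union> C) \<le> r A + card C"
    if "A \<subseteq> B" "B \<subseteq> E" "C \<subseteq> E" for A B C
  proof -
    have "finite C" using that fin finite_subset by blast
    then show ?thesis using that(3)
    proof (induction C)
      case empty
      then show ?case by simp
    next
      case (insert x F)
      then have "r (insert x (A \<union> F)) = r (A \<union> F) + (if spans (A \<union> F) x then 0 else 1)"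
        "r (insert x (B \<union> F)) = r (B \<union> F) + (if spans (B \<union> F) x then 0 else 1)"
        "spans (A \<union> F) x \<Longrightarrow> spans (B \<union> F) x"
        using that step[of "A \<union> F" x] step[of "B \<union> F" x] mono[of "A \<union> F" "B \<union> F" x] by auto
      then show ?case using insert by (auto split: if_splits)
    qed
  qed
  have "r A \<le> card A" if "A \<subseteq> E" for A
    using diff[of "{}" "{}" A] that empty by simp
  moreover have "r A \<le> r B" if "A \<subseteq> B" "B \<subseteq> E" for A B
    using diff[of A A B] that by (simp add: sup.absorb2)
  moreover have "r (A \<union> B) + r (A \<inter> B) \<le> r A + r B" if "A \<subseteq> E" "B \<subseteq> E" for A B
  proof -
    have "A \<inter> B \<union> (B - A) = B" "A \<union> (B - A) = A \<union> B" "B - A \<subseteq> E"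
      using that by auto
    then show ?thesis using diff[of "A \<inter> B" A "B - A"] that by (simp add: add.commute)
  qed
  ultimately show ?thesis using fin unfolding rank_function_def by auto
qed

lemma rank_function_delete:
  assumes "rank_function E r" "E' \<subseteq> E"
  shows "rank_function E' r"
proof -
  have "finite E'" using assms rank_functionD(1) finite_subset by blast
  then show ?thesis using assms unfolding rank_function_def by (meson subset_trans)
qed

text \<open>The rank function of the contraction by a non-loop \<open>e\<close>. The truncated
  subtraction is exact, because \<open>r {e} \<noteq> 0\<close> makes every
  \<open>r (insert e A)\<close> positive.\<close>

lemma rank_function_contract:
  assumes r: "rank_function E r" and e: "e \<in> E" "r {e} \<noteq> 0"
  shows "rank_function (E - {e}) (\<lambda>A. r (insert e A) - 1)"
proof -
  have pos: "1 \<le> r (insert e A)" if "A \<subseteq> E" for A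
    using rank_functionD(3)[OF r, of "{e}" "insert e A"] that e by auto
  have "r (insert e A) - 1 \<le> card A" if "A \<subseteq> E - {e}" for A
  proof -
    have "A \<subseteq> E" "finite A" "e \<notin> A"
      using that rank_functionD(1)[OF r] by (auto dest: finite_subset)
    then show ?thesis
      using rank_functionD(2)[OF r, of "insert e A"] e by auto
  qed
  moreover have "r (insert e A) - 1 \<le> r (insert e B) - 1" if "A \<subseteq> B" "B \<subseteq> E - {e}" for A B
  proof -
    have "insert e A \<subseteq> insert e B" "insert e B \<subseteq> E" using that e by auto
    then show ?thesis by (intro diff_le_mono rank_functionD(3)[OF r])
  qed
  moreover have "r (insert e (A \<union> B)) - 1 + (r (insert e (A \<inter> B)) - 1)
      \<le> r (insert e A) - 1 + (r (insert e B) - 1)"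
    if "A \<subseteq> E - {e}" "B \<subseteq> E - {e}" for A B
  proof -
    have "insert e A \<union> insert e B = insert e (A \<union> B)" "insert e A \<inter> insert e B = insert e (A \<inter> B)"
      by blast+
    moreover have "insert e A \<subseteq> E" "insert e B \<subseteq> E"
      using that e(1) by blast+
    ultimately have "r (insert e (A \<union> B)) + r (insert e (A \<inter> B)) \<le> r (insert e A) + r (insert e B)"
      using rank_functionD(4)[OF r, of "insert e A" "insert e B"] by metis
    moreover have "A \<subseteq> E" "B \<subseteq> E" "A \<union> B \<subseteq> E" "A \<inter> B \<subseteq> E"
      using that by blast+
    ultimately show ?thesis
      using pos[of A] pos[of B] pos[of "A \<union> B"] pos[of "A \<inter> B"] by linarith
  qed
  ultimately show ?thesis
    using rank_functionD(1)[OF r] unfolding rank_function_def by simp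
qed

text \<open>The hard half of the intersection theorem, by induction on the ground set. An element
  that is a loop of neither matroid is deleted or contracted; if both smaller instances violate the
  hypothesis, their violating sets uncross to a contradiction.\<close>

lemma matroid_intersection_ge:
  assumes "rank_function E r1" "rank_function E r2"
    and "\<And>B. B \<subseteq> E \<Longrightarrow> k \<le> r1 B + r2 (E - B)"
  shows "\<exists>I\<subseteq>E. card I = k \<and> r1 I = k \<and> r2 I = k"
  using assms
proof (induction "card E" arbitrary: E r1 r2 k rule: less_induct)
  case less
  note r1 = less.prems(1) and r2 = less.prems(2)
  have finE: "finite E" using r1 rank_functionD(1) by blast
  show ?case
  proof (cases "\<forall>e\<in>E. r1 {e} = 0 \<or> r2 {e} = 0")
    case True
    \<comment> \<open>These are the loops of the first matroid; all other elements are loops of the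
      second, so the hypothesis at this set forces \<open>k = 0\<close>.\<close>
    define A where "A = {e \<in> E. r1 {e} = 0}"
    have "r1 A = 0" by (rule rank_function_loops[OF r1]) (auto simp: A_def)
    moreover have "r2 (E - A) = 0"
      by (rule rank_function_loops[OF r2]) (use True in \<open>auto simp: A_def\<close>)
    moreover have "A \<subseteq> E" unfolding A_def by auto
    ultimately have "k = 0" using less.prems(3)[of A] by simp
    then show ?thesis
      using rank_function_empty[OF r1] rank_function_empty[OF r2] by (intro exI[of _ "{}"]) auto
  next
    case False
    then obtain e where e: "e \<in> E" "r1 {e} \<noteq> 0" "r2 {e} \<noteq> 0" by auto
    have smaller: "card (E - {e}) < card E" using e(1) finE by (meson card_Diff1_less)
    have d1: "rank_function (E - {e}) r1" and d2: "rank_function (E - {e}) r2"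
      using rank_function_delete[OF r1] rank_function_delete[OF r2] by auto
    have c1: "rank_function (E - {e}) (\<lambda>A. r1 (insert e A) - 1)"
      and c2: "rank_function (E - {e}) (\<lambda>A. r2 (insert e A) - 1)"
      using rank_function_contract[OF r1 e(1,2)] rank_function_contract[OF r2 e(1,3)] .
    consider (trivial) "k = 0"
      | (delete) "\<forall>B\<subseteq>E - {e}. k \<le> r1 B + r2 (E - {e} - B)"
      | (contract) "k > 0"
          "\<forall>B\<subseteq>E - {e}. k - 1 \<le> (r1 (insert e B) - 1) + (r2 (insert e (E - {e} - B)) - 1)"
      | (neither) A B where "k > 0"
          "A \<subseteq> E - {e}" "r1 A + r2 (E - {e} - A) < k"
          "B \<subseteq> E - {e}" "(r1 (insert e B) - 1) + (r2 (insert e (E - {e} - B)) - 1) < k - 1"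
    proof (cases "k = 0")
      case True
      then show ?thesis using trivial by blast
    next
      case False
      then have "k > 0" by simp
      then show ?thesis
        using delete contract neither by (metis (no_types, lifting) not_le)
    qed
    then show ?thesis
    proof cases
      case trivial
      then show ?thesis
        using rank_function_empty[OF r1] rank_function_empty[OF r2] by (intro exI[of _ "{}"]) auto
    next
      case delete
      have "\<exists>I\<subseteq>E - {e}. card I = k \<and> r1 I = k \<and> r2 I = k"
        by (rule less.hyps[OF smaller d1 d2]) (use delete in simp)
      then show ?thesis by blast
    next
      case contract
      have "\<exists>I\<subseteq>E - {e}. card I = k - 1 \<and> r1 (insert e I) - 1 = k - 1 \<and> r2 (insert e I) - 1 = k - 1"
        by (rule less.hyps[OF smaller c1 c2]) (use contract in simp)
      then obtain I where I: "I \<subseteq> E - {e}" "card I = k - 1" "r1 (insert e I) - 1 = k - 1"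
          "r2 (insert e I) - 1 = k - 1"
        by blast
      have "I \<subseteq> E" using I(1) by auto
      then have "1 \<le> r1 (insert e I)" "1 \<le> r2 (insert e I)"
        using rank_functionD(3)[OF r1, of "{e}" "insert e I"]
          rank_functionD(3)[OF r2, of "{e}" "insert e I"] e I by auto
      moreover have "card (insert e I) = k"
        using I contract(1) finE by (subst card_insert_disjoint) (auto dest: finite_subset[of I])
      ultimately show ?thesis
        using I e contract(1) by (intro exI[of _ "insert e I"]) auto
    next
      \<comment> \<open>After undoing the two subtractions of 1, the violations add up to at most
        \<open>2 * k - 1\<close>. Submodularity passes this sum on to \<open>A \<inter> B\<close>
        and \<open>insert e (A \<union> B)\<close>, where the hypothesis demands \<open>k\<close>
        twice.\<close>
      case neither
      have AE: "A \<subseteq> E" "B \<subseteq> E" "insert e B \<subseteq> E" using neither e by auto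
      have sets: "insert e (E - {e} - B) = E - B" "A \<union> insert e B = insert e (A \<union> B)"
        "A \<inter> insert e B = A \<inter> B" "(E - {e} - A) \<union> (E - B) = E - (A \<inter> B)"
        "(E - {e} - A) \<inter> (E - B) = E - insert e (A \<union> B)"
        using neither e by auto
      have "e \<notin> B" using neither by auto
      then have "1 \<le> r1 (insert e B)" "1 \<le> r2 (E - B)"
        using rank_functionD(3)[OF r1, of "{e}" "insert e B"]
          rank_functionD(3)[OF r2, of "{e}" "E - B"] e neither AE by auto
      moreover have "r1 (insert e (A \<union> B)) + r1 (A \<inter> B) \<le> r1 A + r1 (insert e B)"
        using rank_functionD(4)[OF r1 AE(1,3)] sets by simp
      moreover have "r2 (E - (A \<inter> B)) + r2 (E - insert e (A \<union> B)) \<le> r2 (E - {e} - A) + r2 (E - B)"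
        using rank_functionD(4)[OF r2, of "E - {e} - A" "E - B"] sets(4,5) by auto
      moreover have "k \<le> r1 (insert e (A \<union> B)) + r2 (E - insert e (A \<union> B))"
        using less.prems(3)[of "insert e (A \<union> B)"] AE by blast
      moreover have "k \<le> r1 (A \<inter> B) + r2 (E - (A \<inter> B))"
        using less.prems(3)[of "A \<inter> B"] AE by blast
      ultimately show ?thesis using neither sets(1) by simp
    qed
  qed
qed

theorem matroid_intersection:
  assumes "rank_function E r1" "rank_function E r2"
  obtains I B where "I \<subseteq> E" "B \<subseteq> E" "r1 I = card I" "r2 I = card I"
    "card I = r1 B + r2 (E - B)"
proof -
  define S where "S = (\<lambda>B. r1 B + r2 (E - B)) ` Pow E"
  have S: "finite S" "S \<noteq> {}"
    using rank_functionD(1)[OF assms(1)] unfolding S_def by auto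
  have "Min S \<in> S" using Min_in[OF S] .
  then obtain B where B: "B \<subseteq> E" "Min S = r1 B + r2 (E - B)" unfolding S_def by auto
  moreover have "\<exists>I\<subseteq>E. card I = Min S \<and> r1 I = Min S \<and> r2 I = Min S"
  proof (rule matroid_intersection_ge[OF assms])
    fix B assume "B \<subseteq> E"
    then show "Min S \<le> r1 B + r2 (E - B)" using S unfolding S_def by (intro Min_le) auto
  qed
  ultimately show ?thesis using that by metis
qed

section \<open>Partition matroids and packings in copies of a ground set\<close>

lemma card_slices:
  fixes m :: nat
  assumes "finite E" "B \<subseteq> E \<times> {..<m}"
  shows "card B = (\<Sum>i<m. card {e. (e, i) \<in> B})"
proof -
  have "finite B" using assms by (meson finite_SigmaI finite_lessThan finite_subset)
  moreover have "snd ` B \<subseteq> {..<m}" using assms by auto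
  ultimately have "card B = (\<Sum>i<m. card {x \<in> B. snd x = i})"
    using sum.group[of B "{..<m}" snd "\<lambda>_. 1::nat"] by simp
  also have "\<dots> = (\<Sum>i<m. card {e. (e, i) \<in> B})"
  proof (rule sum.cong[OF refl])
    fix i
    have "{x \<in> B. snd x = i} = (\<lambda>e. (e, i)) ` {e. (e, i) \<in> B}" by force
    then show "card {x \<in> B. snd x = i} = card {e. (e, i) \<in> B}"
      by (simp add: card_image inj_on_def)
  qed
  finally show ?thesis .
qed

text \<open>The rank function of the partition matroid with classes indexed by \<open>K\<close> and
  capacities \<open>cap\<close>.\<close>

definition partition_rank :: "'c set \<Rightarrow> ('e \<Rightarrow> 'c) \<Rightarrow> ('c \<Rightarrow> nat) \<Rightarrow> 'e set \<Rightarrow> nat" where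
  "partition_rank K \<kappa> cap A = (\<Sum>c\<in>K. min (cap c) (card {e \<in> A. \<kappa> e = c}))"

lemma partition_rank_insert:
  assumes "finite K" "\<kappa> e \<in> K" "finite A"
  shows "partition_rank K \<kappa> cap (insert e A) = partition_rank K \<kappa> cap A
    + (if e \<in> A \<or> cap (\<kappa> e) \<le> card {x \<in> A. \<kappa> x = \<kappa> e} then 0 else 1)"
proof (cases "e \<in> A")
  case True
  then show ?thesis by (simp add: insert_absorb)
next
  case False
  have own: "{x \<in> insert e A. \<kappa> x = \<kappa> e} = insert e {x \<in> A. \<kappa> x = \<kappa> e}" by auto
  have other: "{x \<in> insert e A. \<kappa> x = c} = {x \<in> A. \<kappa> x = c}" if "c \<noteq> \<kappa> e" for c
    using that by auto
  have "card {x \<in> insert e A. \<kappa> x = \<kappa> e} = Suc (card {x \<in> A. \<kappa> x = \<kappa> e})"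
    unfolding own using False assms(3) by (subst card_insert_disjoint) auto
  moreover have "(\<Sum>c\<in>K - {\<kappa> e}. min (cap c) (card {x \<in> insert e A. \<kappa> x = c}))
      = (\<Sum>c\<in>K - {\<kappa> e}. min (cap c) (card {x \<in> A. \<kappa> x = c}))"
    by (rule sum.cong) (use other in auto)
  ultimately show ?thesis
    unfolding partition_rank_def sum.remove[OF assms(1,2)] using False by auto
qed

lemma card_sum_classes:
  assumes "finite K" "finite A" "\<kappa> ` A \<subseteq> K"
  shows "card A = (\<Sum>c\<in>K. card {e \<in> A. \<kappa> e = c})"
  by (simp only: card_eq_sum sum.group[OF assms(2,1,3)])

text \<open>Each summand of the rank is at most the size of its class, so a total as large as
  \<open>card A\<close> leaves no slack in any class.\<close>

lemma partition_rank_independent: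
  assumes "finite K" "finite A" "\<kappa> ` A \<subseteq> K" "card A \<le> partition_rank K \<kappa> cap A" "c \<in> K"
  shows "card {e \<in> A. \<kappa> e = c} \<le> cap c"
proof -
  have "(\<Sum>c\<in>K. min (cap c) (card {e \<in> A. \<kappa> e = c})) = (\<Sum>c\<in>K. card {e \<in> A. \<kappa> e = c})"
  proof (rule antisym)
    show "(\<Sum>c\<in>K. card {e \<in> A. \<kappa> e = c}) \<le> (\<Sum>c\<in>K. min (cap c) (card {e \<in> A. \<kappa> e = c}))"
      using assms(4) unfolding partition_rank_def card_sum_classes[OF assms(1-3)] .
  qed (rule sum_mono, simp)
  then have "min (cap c) (card {e \<in> A. \<kappa> e = c}) = card {e \<in> A. \<kappa> e = c}"
    by (rule sum_mono_inv) (use assms in auto)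
  then show ?thesis by simp
qed

text \<open>The direct sum of \<open>m\<close> copies of a matroid: a set is independent when all
  its slices are.\<close>

lemma rank_function_copies:
  assumes r: "rank_function E r"
  shows "rank_function (E \<times> {..<m::nat}) (\<lambda>B. \<Sum>i<m. r {e. (e, i) \<in> B})"
proof -
  have fin: "finite E" using rank_functionD(1)[OF r] .
  have "(\<Sum>i<m. r {e. (e, i) \<in> B}) \<le> card B" if B: "B \<subseteq> E \<times> {..<m}" for B
  proof -
    have "(\<Sum>i<m. r {e. (e, i) \<in> B}) \<le> (\<Sum>i<m. card {e. (e, i) \<in> B})"
      by (intro sum_mono rank_functionD(2)[OF r]) (use B in auto)
    also have "\<dots> = card B"
      using B fin by (intro card_slices[symmetric]) auto
    finally show ?thesis .
  qed
  moreover have "(\<Sum>i<m. r {e. (e, i) \<in> A}) \<le> (\<Sum>i<m. r {e. (e, i) \<in> B})"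
    if "A \<subseteq> B" "B \<subseteq> E \<times> {..<m}" for A B
    by (intro sum_mono rank_functionD(3)[OF r]) (use that in auto)
  moreover have "(\<Sum>i<m. r {e. (e, i) \<in> A \<union> B}) + (\<Sum>i<m. r {e. (e, i) \<in> A \<inter> B})
      \<le> (\<Sum>i<m. r {e. (e, i) \<in> A}) + (\<Sum>i<m. r {e. (e, i) \<in> B})"
    if "A \<subseteq> E \<times> {..<m}" "B \<subseteq> E \<times> {..<m}" for A B
  proof -
    have "{e. (e, i) \<in> A \<union> B} = {e. (e, i) \<in> A} \<union> {e. (e, i) \<in> B}"
      "{e. (e, i) \<in> A \<inter> B} = {e. (e, i) \<in> A} \<inter> {e. (e, i) \<in> B}" for i
      by auto
    then show ?thesis
      unfolding sum.distrib[symmetric]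
      by (auto intro!: sum_mono rank_functionD(4)[OF r] dest: subsetD[OF that(1)] subsetD[OF that(2)])
  qed
  ultimately show ?thesis
    using fin unfolding rank_function_def by simp
qed

text \<open>In the projected matroid the copies \<open>(e, i)\<close> and \<open>(e, j)\<close> are
  parallel. Independence therefore says at once that no element is used in two copies and that no
  class exceeds its capacity.\<close>

lemma rank_function_partition_projection:
  assumes "finite E" "finite K" "\<kappa> ` E \<subseteq> K"
  shows "rank_function (E \<times> {..<m::nat}) (\<lambda>B. partition_rank K \<kappa> cap (fst ` B))"
proof (rule rank_functionI[where spans = "\<lambda>B x. fst x \<in> fst ` B
    \<or> cap (\<kappa> (fst x)) \<le> card {y \<in> fst ` B. \<kappa> y = \<kappa> (fst x)}"])
  fix B x assume "B \<subseteq> E \<times> {..<m}" "x \<in> E \<times> {..<m}"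
  moreover have "finite (fst ` B)"
    by (rule finite_subset[of _ E]) (use calculation assms(1) in auto)
  ultimately show "partition_rank K \<kappa> cap (fst ` insert x B) = partition_rank K \<kappa> cap (fst ` B)
      + (if fst x \<in> fst ` B \<or> cap (\<kappa> (fst x)) \<le> card {y \<in> fst ` B. \<kappa> y = \<kappa> (fst x)} then 0 else 1)"
    unfolding image_insert using assms by (intro partition_rank_insert) auto
next
  fix A B :: "('a \<times> nat) set" and x :: "'a \<times> nat"
  assume AB: "A \<subseteq> B" "B \<subseteq> E \<times> {..<m}"
    and x: "fst x \<in> fst ` A \<or> cap (\<kappa> (fst x)) \<le> card {y \<in> fst ` A. \<kappa> y = \<kappa> (fst x)}"
  have "finite (fst ` B)"
    by (rule finite_subset[of _ E]) (use AB assms(1) in auto)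
  then have "card {y \<in> fst ` A. \<kappa> y = \<kappa> (fst x)} \<le> card {y \<in> fst ` B. \<kappa> y = \<kappa> (fst x)}"
    using AB by (intro card_mono) auto
  then show "fst x \<in> fst ` B \<or> cap (\<kappa> (fst x)) \<le> card {y \<in> fst ` B. \<kappa> y = \<kappa> (fst x)}"
    using x AB by auto
qed (use assms in \<open>auto simp: partition_rank_def\<close>)

text \<open>The matroid intersection theorem on \<open>m\<close> disjoint copies of the ground set; the dual set is
  symmetrised by intersecting its copies.\<close>

lemma capacitated_packing:
  fixes m :: nat
  assumes r: "rank_function E r" and K: "finite K" "\<kappa> ` E \<subseteq> K"
  obtains A F where "A \<subseteq> E" "\<forall>i<m. F i \<subseteq> E \<and> r (F i) = card (F i) \<and> r (F i \<inter> A) = r A"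
    "disjoint_family_on F {..<m}"
    "\<forall>c\<in>K. card {e \<in> \<Union>(F ` {..<m}). \<kappa> e = c} \<le> cap c"
    "\<forall>c\<in>K. card {e \<in> \<Union>(F ` {..<m}) - A. \<kappa> e = c} = min (cap c) (card {e \<in> E - A. \<kappa> e = c})"
proof -
  have fin: "finite E" using rank_functionD(1)[OF r] .
  let ?h = "partition_rank K \<kappa> cap"
  obtain I B where IB: "I \<subseteq> E \<times> {..<m}" "B \<subseteq> E \<times> {..<m}"
      "(\<Sum>i<m. r {e. (e, i) \<in> I}) = card I" "?h (fst ` I) = card I"
      "card I = (\<Sum>i<m. r {e. (e, i) \<in> B}) + ?h (fst ` (E \<times> {..<m} - B))"
    using matroid_intersection[OF rank_function_copies[OF r, of m]
        rank_function_partition_projection[OF fin K, of m cap]] by metis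
  define F where "F = (\<lambda>i. {e. (e, i) \<in> I})"
  define U where "U = \<Union>(F ` {..<m})"
  \<comment> \<open>Intersecting the slices can only lower their ranks, and it preserves the
    projection of the complement: an element outside \<open>A\<close> has some copy outside
    \<open>B\<close>.\<close>
  define A where "A = {e \<in> E. \<forall>i<m. (e, i) \<in> B}"
  have finI: "finite I" using IB(1) fin by (meson finite_SigmaI finite_lessThan finite_subset)
  have FE: "F i \<subseteq> E" for i using IB(1) unfolding F_def by auto
  have finF: "finite (F i)" for i using FE fin finite_subset by blast
  have U: "fst ` I = U" using IB(1) unfolding U_def F_def by force
  have UE: "U \<subseteq> E" using FE unfolding U_def by auto
  have finU: "finite U" using UE fin finite_subset by blast
  have AE: "A \<subseteq> E" unfolding A_def by auto
  have cardI: "card I = (\<Sum>i<m. card (F i))"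
    using card_slices[of E I m] IB(1) fin unfolding F_def by auto
  have ind: "r (F i) = card (F i)" if "i < m" for i
  proof (rule sum_mono_inv[of "\<lambda>i. r (F i)" "{..<m}" "\<lambda>i. card (F i)"])
    show "(\<Sum>i<m. r (F i)) = (\<Sum>i<m. card (F i))" using IB(3) cardI unfolding F_def by simp
  qed (use rank_functionD(2)[OF r FE] that in auto)
  have h_le: "?h C \<le> card C" if "C \<subseteq> E" for C
    unfolding partition_rank_def
    by (subst card_sum_classes[of K C \<kappa>])
      (use that K fin in \<open>auto intro!: sum_mono dest: finite_subset\<close>)
  \<comment> \<open>The projected rank is at most \<open>card U\<close>, so the independent set
    \<open>I\<close> loses nothing under \<open>fst\<close>. Injectivity of \<open>fst\<close> on
    \<open>I\<close> is disjointness of the slices.\<close>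
  have "card I = card U"
    using IB(4) h_le[OF UE] card_image_le[OF finI, of fst] unfolding U by simp
  then have "inj_on fst I" using U finI by (metis eq_card_imp_inj_on)
  then have disj: "disjoint_family_on F {..<m}"
  proof -
    assume inj: "inj_on fst I"
    have "i = j" if "(e, i) \<in> I" "(e, j) \<in> I" for e i j
      using inj_onD[OF inj, of "(e, i)" "(e, j)"] that by simp
    then show ?thesis unfolding disjoint_family_on_def F_def by blast
  qed
  have cap: "card {e \<in> U. \<kappa> e = c} \<le> cap c" if "c \<in> K" for c
    by (rule partition_rank_independent[OF K(1) finU _ _ that])
      (use UE K(2) IB(4) U \<open>card I = card U\<close> in auto)
  have proj: "fst ` (E \<times> {..<m} - B) = E - A"
    unfolding A_def by force
  have rA: "r A \<le> r {e. (e, i) \<in> B}" if "i < m" for i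
    by (rule rank_functionD(3)[OF r]) (use that IB(2) in \<open>auto simp: A_def\<close>)
  have lower: "(\<Sum>i<m. r A) + ?h (E - A) \<le> card I"
    unfolding IB(5) proj by (intro add_right_mono sum_mono rA) auto
  have FA_ind: "r (F i \<inter> A) = card (F i \<inter> A)" if "i < m" for i
    by (rule rank_function_independent_subset[OF r FE ind[OF that]]) auto
  have FA_le: "card (F i \<inter> A) \<le> r A" if "i < m" for i
    using rank_functionD(3)[OF r, of "F i \<inter> A" A] AE FA_ind[OF that] by auto
  have class_le: "card {e \<in> U - A. \<kappa> e = c} \<le> min (cap c) (card {e \<in> E - A. \<kappa> e = c})" if "c \<in> K" for c
  proof -
    have "card {e \<in> U - A. \<kappa> e = c} \<le> card {e \<in> U. \<kappa> e = c}"
      using finU by (intro card_mono) auto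
    moreover have "card {e \<in> U - A. \<kappa> e = c} \<le> card {e \<in> E - A. \<kappa> e = c}"
      using fin UE by (intro card_mono) auto
    ultimately show ?thesis using cap[OF that] by simp
  qed
  have UA: "card (U - A) = (\<Sum>c\<in>K. card {e \<in> U - A. \<kappa> e = c})"
    by (rule card_sum_classes) (use K finU UE in auto)
  have "card (U \<inter> A) = (\<Sum>i<m. card (F i \<inter> A))"
  proof -
    have "U \<inter> A = (\<Union>i<m. F i \<inter> A)" unfolding U_def by auto
    then show ?thesis
      using disj finF by (simp only:, intro card_UN_disjoint) (auto simp: disjoint_family_on_def)
  qed
  moreover have "card U = card (U \<inter> A) + card (U - A)"
    using finU by (metis card_Diff_subset_Int card_mono finite_Int inf_le1 le_add_diff_inverse)
  \<comment> \<open>Every term on the right is bounded by its counterpart on the left, so this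
    inequality between the sums turns all these bounds into equations.\<close>
  ultimately have total: "(\<Sum>i<m. r A) + ?h (E - A)
      \<le> (\<Sum>i<m. card (F i \<inter> A)) + (\<Sum>c\<in>K. card {e \<in> U - A. \<kappa> e = c})"
    using lower \<open>card I = card U\<close> UA by simp
  have le1: "(\<Sum>i<m. card (F i \<inter> A)) \<le> (\<Sum>i<m. r A)" by (rule sum_mono) (use FA_le in auto)
  have le2: "(\<Sum>c\<in>K. card {e \<in> U - A. \<kappa> e = c}) \<le> ?h (E - A)"
    unfolding partition_rank_def by (rule sum_mono) (use class_le in auto)
  have "card (F i \<inter> A) = r A" if "i < m" for i
    by (rule sum_mono_inv[of "\<lambda>i. card (F i \<inter> A)" "{..<m}" "\<lambda>i. r A"])
      (use total le1 le2 FA_le that in auto)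
  moreover have "card {e \<in> U - A. \<kappa> e = c} = min (cap c) (card {e \<in> E - A. \<kappa> e = c})" if "c \<in> K" for c
    by (rule sum_mono_inv[of "\<lambda>c. card {e \<in> U - A. \<kappa> e = c}" K])
      (use total le1 le2 class_le that K in \<open>auto simp: partition_rank_def\<close>)
  ultimately show ?thesis
    using that[of A F] AE FE ind disj cap FA_ind unfolding U_def by simp
qed

section \<open>Connectivity and parity\<close>

definition adj :: "('e \<Rightarrow> 'v set) \<Rightarrow> 'e set \<Rightarrow> ('v \<times> 'v) set" where
  "adj en A = {(u, v). \<exists>e\<in>A. en e = {u, v}}"

definition conn :: "('e \<Rightarrow> 'v set) \<Rightarrow> 'e set \<Rightarrow> ('v \<times> 'v) set" where
  "conn en A = (adj en A)\<^sup>*"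

lemma conn_refl [simp]: "(v, v) \<in> conn en A"
  unfolding conn_def by simp

lemma conn_trans: "(u, v) \<in> conn en A \<Longrightarrow> (v, w) \<in> conn en A \<Longrightarrow> (u, w) \<in> conn en A"
  unfolding conn_def by (rule rtrancl_trans)

lemma conn_sym: "(u, v) \<in> conn en A \<Longrightarrow> (v, u) \<in> conn en A"
proof -
  have "sym (adj en A)" unfolding adj_def sym_def by (auto simp: insert_commute)
  then show "(u, v) \<in> conn en A \<Longrightarrow> (v, u) \<in> conn en A"
    unfolding conn_def by (meson sym_rtrancl symE)
qed

lemma conn_edge: "e \<in> A \<Longrightarrow> en e = {u, v} \<Longrightarrow> (u, v) \<in> conn en A"
  unfolding conn_def adj_def by blast

text \<open>Reachability is a reflexive transitive closure, so comparing it on single edges is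
  enough.\<close>

lemma conn_replace:
  assumes "\<And>e u v. e \<in> A \<Longrightarrow> en e = {u, v} \<Longrightarrow> (u, v) \<in> conn en B"
  shows "conn en A \<subseteq> conn en B"
proof -
  have "adj en A \<subseteq> conn en B" using assms unfolding adj_def by auto
  then show ?thesis unfolding conn_def by (rule rtrancl_subset_rtrancl)
qed

lemma conn_mono: "A \<subseteq> B \<Longrightarrow> conn en A \<subseteq> conn en B"
  by (rule conn_replace) (auto intro: conn_edge)

text \<open>A route from \<open>u\<close> to \<open>v\<close> needs the new edge at most once, in
  one of its two directions.\<close>

lemma conn_insert:
  assumes "en e = {a, b}" "(u, v) \<in> conn en (insert e A)"
  shows "(u, v) \<in> conn en A \<or> (u, a) \<in> conn en A \<and> (b, v) \<in> conn en A
    \<or> (u, b) \<in> conn en A \<and> (a, v) \<in> conn en A"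
proof -
  have "(u, v) \<in> (adj en (insert e A))\<^sup>*" using assms(2) unfolding conn_def .
  then show ?thesis
  proof (induction rule: rtrancl_induct)
    case base
    then show ?case by simp
  next
    case (step y z)
    then have "(y, z) \<in> conn en A \<or> {y, z} = {a, b}"
      using assms(1) unfolding adj_def by (auto intro: conn_edge)
    then consider "(y, z) \<in> conn en A" | "y = a" "z = b" | "y = b" "z = a"
      by (auto simp: doubleton_eq_iff)
    then show ?case
      using step.IH by cases (auto intro: conn_trans)
  qed
qed

definition connects :: "('e \<Rightarrow> 'v set) \<Rightarrow> 'e set \<Rightarrow> 'v set \<Rightarrow> bool" where
  "connects en A W \<longleftrightarrow> (\<forall>u\<in>W. \<forall>v\<in>W. (u, v) \<in> conn en A)"

lemma connectsI:
  assumes "\<And>u. u \<in> W \<Longrightarrow> (x, u) \<in> conn en A"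
  shows "connects en A W"
  unfolding connects_def
proof (intro ballI)
  fix u v assume "u \<in> W" "v \<in> W"
  then show "(u, v) \<in> conn en A" by (rule conn_trans[OF conn_sym[OF assms] assms])
qed

definition component :: "('e \<Rightarrow> 'v set) \<Rightarrow> 'e set \<Rightarrow> 'v \<Rightarrow> 'v set" where
  "component en A v = {u. (v, u) \<in> conn en A}"

lemma component_eq_iff: "component en A u = component en A v \<longleftrightarrow> (u, v) \<in> conn en A"
  unfolding component_def by (auto intro: conn_trans conn_sym)

text \<open>The rank function of the cycle matroid, as vertices minus components. For finite
  \<open>V\<close> there are at most \<open>card V\<close> classes, so the subtraction is
  exact.\<close>

definition graphic_rank :: "('e \<Rightarrow> 'v set) \<Rightarrow> 'v set \<Rightarrow> 'e set \<Rightarrow> nat" where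
  "graphic_rank en V A = card V - card (component en A ` V)"

lemma graphic_rank_insert:
  assumes V: "finite V" "a \<in> V" "b \<in> V" and e: "en e = {a, b}"
  shows "graphic_rank en V (insert e A) = graphic_rank en V A + (if (a, b) \<in> conn en A then 0 else 1)"
proof (cases "(a, b) \<in> conn en A")
  case True
  have "conn en (insert e A) = conn en A"
  proof
    show "conn en (insert e A) \<subseteq> conn en A"
    proof (rule conn_replace)
      fix x u v assume "x \<in> insert e A" "en x = {u, v}"
      then show "(u, v) \<in> conn en A"
        using e True conn_sym[OF True] by (auto intro: conn_edge simp: doubleton_eq_iff)
    qed
  qed (rule conn_mono, blast)
  then show ?thesis using True unfolding graphic_rank_def component_def by simp
next
  case False
  let ?C = "component en A" and ?C' = "component en (insert e A)"
  let ?M = "?C a \<union> ?C b"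
  have mono: "conn en A \<subseteq> conn en (insert e A)" by (rule conn_mono) auto
  have ab: "(a, b) \<in> conn en (insert e A)" using e by (auto intro: conn_edge)
  have Ca: "?C' a = ?M"
  proof (intro equalityI subsetI)
    fix x assume "x \<in> ?C' a"
    then show "x \<in> ?M"
      using conn_insert[where en = en, OF e, of a x A] unfolding component_def by auto
  next
    fix x assume "x \<in> ?M"
    then consider "(a, x) \<in> conn en A" | "(b, x) \<in> conn en A" unfolding component_def by auto
    then have "(a, x) \<in> conn en (insert e A)"
    proof cases
      case 1
      then show ?thesis using mono by auto
    next
      case 2
      then show ?thesis using conn_trans[OF ab, of x] mono by auto
    qed
    then show "x \<in> ?C' a" unfolding component_def by simp
  qed
  \<comment> \<open>The old classes in \<open>P\<close> merge into the single new class
    \<open>M\<close> and all others survive unchanged, so the number of classes drops by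
    one.\<close>
  define M where "M = ?C' a"
  define P where "P = {?C a, ?C b}"
  have inM: "v \<in> M \<longleftrightarrow> ?C v \<in> P" for v
    unfolding M_def Ca P_def insert_iff empty_iff component_eq_iff
    unfolding component_def by (auto intro: conn_sym)
  have merged: "?C' v = M" if "v \<in> M" for v
  proof -
    have "(a, v) \<in> conn en (insert e A)" using that unfolding M_def component_def by auto
    then show ?thesis unfolding M_def component_eq_iff by (rule conn_sym)
  qed
  have kept: "?C' v = ?C v" if "v \<notin> M" for v
  proof (rule set_eqI)
    fix x
    have "(v, a) \<notin> conn en A" "(v, b) \<notin> conn en A"
      using that unfolding inM P_def by (auto simp: component_eq_iff)
    then show "x \<in> ?C' v \<longleftrightarrow> x \<in> ?C v"
      using conn_insert[where en = en, OF e, of v x A] subsetD[OF mono, of "(v, x)"]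
      unfolding component_def mem_Collect_eq by metis
  qed
  have "a \<in> M" unfolding M_def component_def by simp
  have img: "?C' ` V = insert M (?C ` V - P)"
  proof (intro equalityI subsetI)
    fix W assume "W \<in> ?C' ` V"
    then obtain v where "v \<in> V" "W = ?C' v" by blast
    then show "W \<in> insert M (?C ` V - P)"
      using merged[of v] kept[of v] inM[of v] by (cases "v \<in> M") simp_all
  next
    fix W assume "W \<in> insert M (?C ` V - P)"
    then consider "W = M" | v where "v \<in> V" "W = ?C v" "?C v \<notin> P" by blast
    then show "W \<in> ?C' ` V"
    proof cases
      case 1
      then show ?thesis unfolding M_def using V(2) by blast
    next
      case (2 v)
      then have "W = ?C' v" using kept[of v] inM[of v] by simp
      then show ?thesis using 2(1) by blast
    qed
  qed
  have "M \<notin> ?C ` V - P"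
  proof
    assume "M \<in> ?C ` V - P"
    then obtain v where v: "M = ?C v" "?C v \<notin> P" by blast
    have "(v, a) \<in> conn en A" using \<open>a \<in> M\<close> unfolding v(1) by (simp add: component_def)
    then have "?C v = ?C a" by (simp add: component_eq_iff)
    then show False using v(2) unfolding P_def by simp
  qed
  then have "card (?C' ` V) = Suc (card (?C ` V - P))"
    unfolding img using V(1) by (intro card_insert_disjoint) auto
  moreover have "P \<subseteq> ?C ` V" using V unfolding P_def by auto
  then have "card (?C ` V - P) = card (?C ` V) - card P" "card P \<le> card (?C ` V)"
    using V(1) by (auto intro!: card_Diff_subset card_mono dest: finite_subset)
  moreover have "card P = 2" unfolding P_def using False by (simp add: component_eq_iff)
  moreover have "card (?C ` V) \<le> card V" using V by (intro card_image_le)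
  ultimately have "card (?C ` V) = Suc (card (?C' ` V))" "card (?C ` V) \<le> card V" by linarith+
  then show ?thesis using False unfolding graphic_rank_def by simp
qed

lemma graphic_rank_empty:
  "finite V \<Longrightarrow> graphic_rank en V {} = 0"
  unfolding graphic_rank_def component_def conn_def adj_def by (simp add: card_image)

lemma rank_function_graphic:
  assumes "finite V" "finite E" "\<And>e. e \<in> E \<Longrightarrow> en e \<subseteq> V \<and> card (en e) = 2"
  shows "rank_function E (graphic_rank en V)"
proof (rule rank_functionI[where spans = "\<lambda>A e. \<exists>a b. en e = {a, b} \<and> (a, b) \<in> conn en A"])
  fix A e assume "e \<in> E"
  then obtain a b where ab: "a \<in> V" "b \<in> V" "en e = {a, b}"
    using assms(3) by (metis card_2_iff insert_subset)
  have "(\<exists>a b. en e = {a, b} \<and> (a, b) \<in> conn en A) \<longleftrightarrow> (a, b) \<in> conn en A"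
    using ab(3) conn_sym by (auto simp: doubleton_eq_iff)
  then show "graphic_rank en V (insert e A) = graphic_rank en V A
      + (if \<exists>a b. en e = {a, b} \<and> (a, b) \<in> conn en A then 0 else 1)"
    using graphic_rank_insert[OF assms(1) ab(1,2), of en e A] ab(3) by simp
next
  fix A B e assume "A \<subseteq> B" "\<exists>a b. en e = {a, b} \<and> (a, b) \<in> conn en A"
  then show "\<exists>a b. en e = {a, b} \<and> (a, b) \<in> conn en B"
    using conn_mono[of A B en] by blast
qed (use assms graphic_rank_empty in auto)

text \<open>If an edge of \<open>A\<close> joined two classes of \<open>B\<close>, adding it to
  \<open>B\<close> would raise the rank above that of \<open>A\<close>.\<close>

lemma conn_eq_of_graphic_rank_eq:
  assumes V: "finite V" and E: "finite E" "\<And>e. e \<in> E \<Longrightarrow> en e \<subseteq> V \<and> card (en e) = 2"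
    and A: "A \<subseteq> E" "B \<subseteq> A" and eq: "graphic_rank en V B = graphic_rank en V A"
  shows "conn en B = conn en A"
proof
  show "conn en A \<subseteq> conn en B"
  proof (rule conn_replace)
    fix e u v assume e: "e \<in> A" "en e = {u, v}"
    then have "u \<in> V" "v \<in> V" using E(2)[of e] A by auto
    then have "graphic_rank en V (insert e B)
        = graphic_rank en V B + (if (u, v) \<in> conn en B then 0 else 1)"
      using graphic_rank_insert[of V u v en e] V e by simp
    moreover have "graphic_rank en V (insert e B) \<le> graphic_rank en V A"
      by (rule rank_functionD(3)[OF rank_function_graphic[of V E en]]) (use V E A e in auto)
    ultimately show "(u, v) \<in> conn en B" using eq by (auto split: if_splits)
  qed
qed (rule conn_mono[OF A(2)])

lemma conn_of_graphic_rank_full: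
  assumes "finite V" "card V \<le> Suc (graphic_rank en V A)" "u \<in> V" "v \<in> V"
  shows "(u, v) \<in> conn en A"
proof -
  have "card (component en A ` V) \<le> card V" using assms by (intro card_image_le)
  moreover have "card V > 0" using assms by (auto simp: card_gt_0_iff)
  ultimately have "card (component en A ` V) \<le> 1" using assms(2) unfolding graphic_rank_def by simp
  then have "component en A u = component en A v"
    using assms by (metis One_nat_def card_le_Suc0_iff_eq finite_imageI imageI)
  then show ?thesis using component_eq_iff by metis
qed

lemma graphic_rank_le: "finite V \<Longrightarrow> V \<noteq> {} \<Longrightarrow> Suc (graphic_rank en V A) \<le> card V"
  unfolding graphic_rank_def
  by (metis Suc_leI card_gt_0_iff diff_less finite_imageI image_is_empty)

section \<open>Parity of degrees and joins\<close>

definition odd_at :: "('e \<Rightarrow> 'v set) \<Rightarrow> 'e set \<Rightarrow> 'v \<Rightarrow> bool" where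
  "odd_at en A v \<longleftrightarrow> odd (card {e \<in> A. v \<in> en e})"

lemma odd_at_Un:
  assumes "finite A" "finite B" "A \<inter> B = {}"
  shows "odd_at en (A \<union> B) v \<longleftrightarrow> odd_at en A v \<noteq> odd_at en B v"
proof -
  have "{e \<in> A \<union> B. v \<in> en e} = {e \<in> A. v \<in> en e} \<union> {e \<in> B. v \<in> en e}" by auto
  moreover have "{e \<in> A. v \<in> en e} \<inter> {e \<in> B. v \<in> en e} = {}" using assms by auto
  ultimately show ?thesis
    using assms unfolding odd_at_def by (simp add: card_Un_disjoint)
qed

lemma odd_at_symdiff:
  assumes "finite A" "finite B"
  shows "odd_at en (A - B \<union> (B - A)) v \<longleftrightarrow> odd_at en A v \<noteq> odd_at en B v"
proof -
  have "odd_at en (A - B \<union> (B - A)) v \<longleftrightarrow> odd_at en (A - B) v \<noteq> odd_at en (B - A) v"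
    using assms by (intro odd_at_Un) auto
  moreover have "odd_at en ((A - B) \<union> (A \<inter> B)) v \<longleftrightarrow> odd_at en (A - B) v \<noteq> odd_at en (A \<inter> B) v"
    using assms by (intro odd_at_Un) auto
  moreover have "odd_at en ((B - A) \<union> (A \<inter> B)) v \<longleftrightarrow> odd_at en (B - A) v \<noteq> odd_at en (A \<inter> B) v"
    using assms by (intro odd_at_Un) auto
  moreover have "(A - B) \<union> (A \<inter> B) = A" "(B - A) \<union> (A \<inter> B) = B" by auto
  ultimately show ?thesis by auto
qed

text \<open>The edges of a route from \<open>u\<close> to \<open>v\<close> are added modulo 2. With
  the inequality of truth values, the case \<open>u = v\<close> correctly asks for no odd
  vertex.\<close>

lemma odd_at_path:
  assumes "finite B" "\<And>e. e \<in> B \<Longrightarrow> card (en e) = 2" "(u, v) \<in> conn en B"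
  shows "\<exists>J\<subseteq>B. \<forall>x. odd_at en J x \<longleftrightarrow> (x = u) \<noteq> (x = v)"
proof -
  have "(u, v) \<in> (adj en B)\<^sup>*" using assms(3) unfolding conn_def .
  then show ?thesis
  proof (induction rule: rtrancl_induct)
    case base
    show ?case by (rule exI[of _ "{}"]) (simp add: odd_at_def)
  next
    case (step y z)
    then obtain J where J: "J \<subseteq> B" "\<forall>x. odd_at en J x \<longleftrightarrow> (x = u) \<noteq> (x = y)" by blast
    obtain e where e: "e \<in> B" "en e = {y, z}" using step.hyps unfolding adj_def by auto
    have "y \<noteq> z" using assms(2)[OF e(1)] e(2) by auto
    have "{d. d = e \<and> x \<in> en d} = (if x = y \<or> x = z then {e} else {})" for x using e by auto
    then have single: "odd_at en {e} x \<longleftrightarrow> x = y \<or> x = z" for x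
      unfolding odd_at_def by simp
    have "finite J" using J assms(1) finite_subset by blast
    then have "odd_at en (J - {e} \<union> ({e} - J)) x \<longleftrightarrow> (x = u) \<noteq> (x = z)" for x
      using odd_at_symdiff[of J "{e}" en x] J(2) single \<open>y \<noteq> z\<close> by auto
    moreover have "J - {e} \<union> ({e} - J) \<subseteq> B" using J e by auto
    ultimately show ?case by blast
  qed
qed

text \<open>Every edge of \<open>K\<close> is exchanged for edges of \<open>B\<close> that are odd
  exactly at its two ends, and these sets are added modulo 2. The result is a join in
  \<open>B\<close> for the odd vertices of \<open>K\<close>.\<close>

lemma odd_at_join:
  assumes B: "finite B" "\<And>e. e \<in> B \<Longrightarrow> card (en e) = 2"
    and K: "finite K" "\<And>e. e \<in> K \<Longrightarrow> card (en e) = 2"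
    and span: "\<And>e u v. e \<in> K \<Longrightarrow> en e = {u, v} \<Longrightarrow> (u, v) \<in> conn en B"
  shows "\<exists>J\<subseteq>B. \<forall>x. odd_at en J x \<longleftrightarrow> odd_at en K x"
  using K span
proof (induction K)
  case empty
  then show ?case by blast
next
  case (insert e K)
  have "\<exists>J\<subseteq>B. \<forall>x. odd_at en J x \<longleftrightarrow> odd_at en K x"
  proof (rule insert.IH)
    show "card (en d) = 2" if "d \<in> K" for d
      using insert.prems(1) that by blast
    show "(x, y) \<in> conn en B" if "d \<in> K" "en d = {x, y}" for d x y
      using insert.prems(2)[of d x y] that by blast
  qed
  then obtain J where J: "J \<subseteq> B" "\<forall>x. odd_at en J x \<longleftrightarrow> odd_at en K x" by blast
  obtain u v where uv: "en e = {u, v}" "u \<noteq> v"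
    using insert.prems(1)[of e] by (auto simp: card_2_iff)
  then obtain L where L: "L \<subseteq> B" "\<forall>x. odd_at en L x \<longleftrightarrow> (x = u) \<noteq> (x = v)"
    using odd_at_path[where en = en and u = u and v = v, OF B] insert.prems(2)[of e u v] by blast
  have "{d. d = e \<and> x \<in> en d} = (if x = u \<or> x = v then {e} else {})" for x using uv by auto
  then have "odd_at en {e} x \<longleftrightarrow> (x = u) \<noteq> (x = v)" for x
    using uv(2) unfolding odd_at_def by auto
  then have "odd_at en (insert e K) x \<longleftrightarrow> ((x = u) \<noteq> (x = v)) \<noteq> odd_at en K x" for x
    using odd_at_Un[of "{e}" K en x] insert.hyps by auto
  moreover have "finite J" "finite L" using J L B(1) finite_subset by blast+
  ultimately have "odd_at en (J - L \<union> (L - J)) x \<longleftrightarrow> odd_at en (insert e K) x" for x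
    using odd_at_symdiff[of J L en x] J(2) L(2) by auto
  moreover have "J - L \<union> (L - J) \<subseteq> B" using J L by auto
  ultimately show ?case by blast
qed

section \<open>Closed trails\<close>

lemma walk_Nil: "walk G vs [] \<longleftrightarrow> (\<exists>v\<in>verts G. vs = [v])"
  unfolding walk_def by (auto simp: length_Suc_conv)

lemma walk_Cons: "walk G vs (e # es) \<longleftrightarrow>
    (\<exists>u ws. vs = u # ws \<and> u \<in> verts G \<and> e \<in> edges G \<and> ends G e = {u, hd ws} \<and> walk G ws es)"
proof (cases vs)
  case Nil
  then show ?thesis unfolding walk_def by simp
next
  case (Cons u ws)
  have "(\<forall>i<Suc (length es). ends G ((e # es) ! i) = {(u # ws) ! i, (u # ws) ! Suc i}) \<longleftrightarrow>
      ends G e = {u, ws ! 0} \<and> (\<forall>i<length es. ends G (es ! i) = {ws ! i, ws ! Suc i})"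
    by (subst All_less_Suc2) simp
  moreover have "hd ws = ws ! 0" if "length ws = Suc (length es)"
    using that by (intro hd_conv_nth) auto
  ultimately show ?thesis unfolding Cons walk_def by auto
qed

lemma walk_nonempty: "walk G vs es \<Longrightarrow> vs \<noteq> []"
  unfolding walk_def by auto

lemma walk_set_edges: "walk G vs es \<Longrightarrow> set es \<subseteq> edges G"
  unfolding walk_def by simp

lemma walk_set_verts: "walk G vs es \<Longrightarrow> set vs \<subseteq> verts G"
  unfolding walk_def by simp

lemma walk_hd_last:
  assumes "walk G vs es"
  shows "hd vs \<in> verts G" "last vs \<in> verts G"
  using walk_set_verts[OF assms] hd_in_set[OF walk_nonempty[OF assms]]
    last_in_set[OF walk_nonempty[OF assms]] by blast+

lemma walk_ends_subset: "walk G vs es \<Longrightarrow> e \<in> set es \<Longrightarrow> ends G e \<subseteq> set vs"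
proof (induction es arbitrary: vs)
  case (Cons d es)
  then obtain u ws where ws: "vs = u # ws" "ends G d = {u, hd ws}" "walk G ws es"
    unfolding walk_Cons by blast
  then show ?case
    using Cons walk_nonempty[OF ws(3)] hd_in_set[of ws] by (cases "e = d") auto
qed simp

lemma walk_conn: "walk G vs es \<Longrightarrow> w \<in> set vs \<Longrightarrow> (hd vs, w) \<in> conn (ends G) (set es)"
proof (induction es arbitrary: vs)
  case Nil
  then show ?case unfolding walk_Nil by auto
next
  case (Cons e es)
  then obtain u ws where ws: "vs = u # ws" "ends G e = {u, hd ws}" "walk G ws es"
    unfolding walk_Cons by blast
  show ?case
  proof (cases "w = u")
    case False
    then have "(hd ws, w) \<in> conn (ends G) (set es)" using Cons ws by auto
    then have "(hd ws, w) \<in> conn (ends G) (set (e # es))"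
      using conn_mono[of "set es" "set (e # es)" "ends G"] by auto
    moreover have "(u, hd ws) \<in> conn (ends G) (set (e # es))"
      by (rule conn_edge[of e]) (use ws in auto)
    ultimately show ?thesis using ws(1) conn_trans[of u "hd ws"] by simp
  qed (use ws in simp)
qed

lemma walk_append:
  assumes "walk G vs es" "walk G ws fs" "last vs = hd ws"
  shows "walk G (vs @ tl ws) (es @ fs)"
  using assms(1,3)
proof (induction es arbitrary: vs)
  case Nil
  then have "vs @ tl ws = ws"
    using walk_nonempty[OF assms(2)] unfolding walk_Nil by auto
  then show ?case using assms(2) by simp
next
  case (Cons e es)
  then obtain u us where us: "vs = u # us" "u \<in> verts G" "e \<in> edges G" "ends G e = {u, hd us}"
      "walk G us es"
    unfolding walk_Cons by blast
  then have "walk G (us @ tl ws) (es @ fs)" using Cons walk_nonempty[OF us(5)] by simp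
  moreover have "hd (us @ tl ws) = hd us" using walk_nonempty[OF us(5)] by simp
  ultimately show ?case using us by (auto simp: walk_Cons)
qed

lemma walk_split:
  assumes "walk G vs es" "w \<in> set vs"
  obtains vs1 es1 vs2 es2 where "es = es1 @ es2" "walk G vs1 es1" "walk G vs2 es2"
    "hd vs1 = hd vs" "last vs1 = w" "hd vs2 = w" "last vs2 = last vs"
proof -
  have "\<exists>vs1 es1 vs2 es2. es = es1 @ es2 \<and> walk G vs1 es1 \<and> walk G vs2 es2 \<and>
      hd vs1 = hd vs \<and> last vs1 = w \<and> hd vs2 = w \<and> last vs2 = last vs"
    using assms
  proof (induction es arbitrary: vs)
    case Nil
    then have ends: "hd vs = w" "last vs = w" unfolding walk_Nil by auto
    show ?case
      by (rule exI[of _ vs], rule exI[of _ "[]"], rule exI[of _ vs], rule exI[of _ "[]"])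
        (use ends Nil.prems(1) in simp)
  next
    case (Cons e es)
    obtain u us where us: "vs = u # us" "u \<in> verts G" "e \<in> edges G" "ends G e = {u, hd us}"
        "walk G us es"
      using Cons.prems(1) unfolding walk_Cons by blast
    note us_ne = walk_nonempty[OF us(5)]
    show ?case
    proof (cases "w = u")
      case True
      then have start: "walk G [u] []" "hd [u] = hd vs" "last [u] = w" "hd vs = w"
        using us by (auto simp: walk_Nil)
      show ?thesis
        by (rule exI[of _ "[u]"], rule exI[of _ "[]"], rule exI[of _ vs],
            rule exI[of _ "e # es"]) (use start Cons.prems(1) in simp)
    next
      case False
      then have "w \<in> set us" using Cons.prems us by simp
      then obtain vs1 es1 vs2 es2 where IH: "es = es1 @ es2" "walk G vs1 es1" "walk G vs2 es2"
          "hd vs1 = hd us" "last vs1 = w" "hd vs2 = w" "last vs2 = last us"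
        using Cons.IH[OF us(5)] by blast
      have step: "walk G (u # vs1) (e # es1)" unfolding walk_Cons using us IH by simp
      have ends: "hd (u # vs1) = hd vs" "last (u # vs1) = w" "last vs2 = last vs"
        using IH us us_ne walk_nonempty[OF IH(2)] by auto
      show ?thesis
        by (rule exI[of _ "u # vs1"], rule exI[of _ "e # es1"], rule exI[of _ vs2], rule exI[of _ es2])
          (use step ends IH(1,3,6) in simp)
    qed
  qed
  then show ?thesis using that by blast
qed

lemma conn_walk:
  assumes G: "\<And>e. e \<in> A \<Longrightarrow> e \<in> edges G \<and> ends G e \<subseteq> verts G" and u: "u \<in> verts G"
    and uv: "(u, v) \<in> conn (ends G) A"
  shows "\<exists>vs es. walk G vs es \<and> hd vs = u \<and> last vs = v"
proof -
  have "(u, v) \<in> (adj (ends G) A)\<^sup>*" using uv unfolding conn_def .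
  then show ?thesis
  proof (induction rule: rtrancl_induct)
    case base
    show ?case using u by (intro exI[of _ "[u]"] exI[of _ "[]"]) (simp add: walk_Nil)
  next
    case (step y z)
    then obtain vs es where w: "walk G vs es" "hd vs = u" "last vs = y" by blast
    obtain e where e: "e \<in> A" "ends G e = {y, z}" using step.hyps unfolding adj_def by auto
    then have "walk G [y, z] [e]" using G[OF e(1)] by (auto simp: walk_Cons walk_Nil)
    then have "walk G (vs @ [z]) (es @ [e])" using walk_append[OF w(1), of "[y, z]" "[e]"] w(3) by simp
    moreover have "hd (vs @ [z]) = u" "last (vs @ [z]) = z" using w(2) walk_nonempty[OF w(1)] by auto
    ultimately show ?case by blast
  qed
qed

text \<open>Each edge is met once and contributes its tail, an entry of \<open>butlast vs\<close>,
  and its head, an entry of \<open>tl vs\<close>; these differ because an edge has two ends.\<close>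

lemma trail_degree:
  assumes "multigraph G" "walk G vs es" "distinct es"
  shows "card {e \<in> set es. x \<in> ends G e} = count_list (butlast vs) x + count_list (tl vs) x"
  using assms(2,3)
proof (induction es arbitrary: vs)
  case Nil
  then show ?case unfolding walk_Nil by auto
next
  case (Cons e es)
  then obtain u us where us: "vs = u # us" "e \<in> edges G" "ends G e = {u, hd us}" "walk G us es"
    unfolding walk_Cons by blast
  obtain w ws where ws: "us = w # ws" using walk_nonempty[OF us(4)] by (cases us) auto
  have "u \<noteq> w"
  proof
    assume "u = w"
    then have "card (ends G e) = 1" using us(3) ws by simp
    then show False using assms(1) us(2) unfolding multigraph_def by auto
  qed
  have IH: "card {d \<in> set es. x \<in> ends G d} = count_list (butlast us) x + count_list (tl us) x"
    using Cons us by simp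
  have "{d \<in> set (e # es). x \<in> ends G d}
      = (if x \<in> ends G e then insert e {d \<in> set es. x \<in> ends G d} else {d \<in> set es. x \<in> ends G d})"
    by auto
  then have "card {d \<in> set (e # es). x \<in> ends G d}
      = (if x = u \<or> x = w then 1 else 0) + card {d \<in> set es. x \<in> ends G d}"
    using Cons.prems(2) us(3) ws by simp
  then show ?case unfolding IH using us(1) ws \<open>u \<noteq> w\<close> by auto
qed

lemma count_butlast_tl:
  assumes "vs \<noteq> []"
  shows "count_list (butlast vs) x + (if last vs = x then 1 else 0)
    = count_list (tl vs) x + (if hd vs = x then 1 else 0)"
proof -
  have "count_list vs x = count_list (butlast vs) x + (if last vs = x then 1 else 0)"
    by (subst append_butlast_last_id[OF assms, symmetric]) (simp del: append_butlast_last_id)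
  moreover have "count_list vs x = count_list (tl vs) x + (if hd vs = x then 1 else 0)"
    using assms by (cases vs) auto
  ultimately show ?thesis by simp
qed

lemma closed_trail_degree:
  assumes "multigraph G" "closed_trail G vs es"
  shows "card {e \<in> set es. x \<in> ends G e} = 2 * count_list (tl vs) x"
proof -
  have w: "walk G vs es" "distinct es" "hd vs = last vs" using assms(2) unfolding closed_trail_def by auto
  then have "count_list (butlast vs) x = count_list (tl vs) x"
    using count_butlast_tl[OF walk_nonempty[OF w(1)], of x] by simp
  then show ?thesis using trail_degree[OF assms(1) w(1,2), of x] by simp
qed

lemma closed_trail_even: "multigraph G \<Longrightarrow> closed_trail G vs es \<Longrightarrow> \<not> odd_at (ends G) (set es) x"
  unfolding odd_at_def by (simp add: closed_trail_degree)

lemma length_trail_le: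
  assumes "finite B" "distinct es" "set es \<subseteq> B"
  shows "length es \<le> card B"
  using card_mono[OF assms(1,3)] distinct_card[OF assms(2)] by simp

text \<open>A longest trail from \<open>w\<close> in \<open>B\<close> must close up: at a last
  vertex other than \<open>w\<close> it has used an odd number of edges, while \<open>B\<close> has
  an even number there, so it could be extended.\<close>

lemma closed_trail_through_edge:
  assumes G: "multigraph G" and B: "B \<subseteq> edges G" "\<And>v. \<not> odd_at (ends G) B v"
    and e: "e \<in> B" "w \<in> ends G e"
  obtains vs es where "closed_trail G vs es" "set es \<subseteq> B" "es \<noteq> []" "hd vs = w"
proof -
  have finB: "finite B" using G B(1) finite_subset unfolding multigraph_def by blast
  have incident: "\<exists>z. ends G d = {y, z} \<and> y \<in> verts G \<and> z \<in> verts G"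
    if "d \<in> B" "y \<in> ends G d" for d y
  proof -
    have "ends G d \<subseteq> verts G" "card (ends G d) = 2" using that B(1) G unfolding multigraph_def by auto
    then show ?thesis using that(2) by (auto simp: card_2_iff)
  qed
  define P where "P = (\<lambda>(vs, es). walk G vs es \<and> distinct es \<and> set es \<subseteq> B \<and> hd vs = w)"
  obtain z where z: "ends G e = {w, z}" "w \<in> verts G" "z \<in> verts G" using incident[OF e] by blast
  have start: "P ([w, z], [e])" unfolding P_def using z e B(1) by (auto simp: walk_Cons walk_Nil)
  have "\<exists>t. P t \<and> (\<forall>t'. P t' \<longrightarrow> length (snd t') \<le> length (snd t))"
    by (rule ex_has_greatest_nat[where P = P and b = "Suc (card B)", OF start])
      (use length_trail_le[OF finB] in \<open>auto simp: P_def less_Suc_eq_le\<close>)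
  then obtain vs es where P: "P (vs, es)" and max: "\<And>vs' es'. P (vs', es') \<Longrightarrow> length es' \<le> length es"
    by auto
  have t: "walk G vs es" "distinct es" "set es \<subseteq> B" "hd vs = w" using P unfolding P_def by auto
  have "last vs = w"
  proof (rule ccontr)
    assume ne: "last vs \<noteq> w"
    let ?y = "last vs"
    have "count_list (tl vs) ?y = Suc (count_list (butlast vs) ?y)"
      using count_butlast_tl[OF walk_nonempty[OF t(1)], of ?y] ne t(4) by simp
    then have "odd_at (ends G) (set es) ?y"
      using trail_degree[OF G t(1,2), of ?y] unfolding odd_at_def by simp
    then have "set es \<noteq> B \<and> {d \<in> set es. ?y \<in> ends G d} \<noteq> {d \<in> B. ?y \<in> ends G d}"
      using B(2)[of ?y] unfolding odd_at_def by auto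
    then obtain d where d: "d \<in> B" "?y \<in> ends G d" "d \<notin> set es" using t(3) by auto
    obtain x where x: "ends G d = {?y, x}" "?y \<in> verts G" "x \<in> verts G"
      using incident[OF d(1,2)] by blast
    have "walk G [?y, x] [d]" using x d B(1) by (auto simp: walk_Cons walk_Nil)
    then have "walk G (vs @ [x]) (es @ [d])" using walk_append[OF t(1), of "[?y, x]" "[d]"] by simp
    then have "P (vs @ [x], es @ [d])"
      unfolding P_def using t d walk_nonempty[OF t(1)] by auto
    then show False using max[of "vs @ [x]" "es @ [d]"] by simp
  qed
  moreover have "es \<noteq> []" using max[OF start] by auto
  ultimately show ?thesis
    using that[of vs es] t unfolding closed_trail_def by auto
qed

text \<open>Once the walk has used all edges of \<open>A\<close> that touch it, its vertex set
  cannot be left along \<open>A\<close>.\<close>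

lemma verts_subset_of_saturated_walk:
  assumes "walk G vs es" "u \<in> set vs" "(u, v) \<in> conn (ends G) A"
    and sat: "\<And>e. e \<in> A \<Longrightarrow> ends G e \<inter> set vs \<noteq> {} \<Longrightarrow> e \<in> set es"
  shows "v \<in> set vs"
proof -
  have "(u, v) \<in> (adj (ends G) A)\<^sup>*" using assms(3) unfolding conn_def .
  then show ?thesis
  proof (induction rule: rtrancl_induct)
    case base
    show ?case using assms(2) .
  next
    case (step y z)
    then obtain e where e: "e \<in> A" "ends G e = {y, z}" unfolding adj_def by auto
    then have "e \<in> set es" using sat[of e] step.IH by auto
    then show ?case using walk_ends_subset[OF assms(1)] e(2) by auto
  qed
qed

lemma euler_trail:
  assumes G: "multigraph G" and A: "A \<subseteq> edges G" "verts G \<noteq> {}"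
    and conn: "connects (ends G) A (verts G)" and even: "\<forall>v. \<not> odd_at (ends G) A v"
  obtains vs es where "spanning_closed_trail G vs es" "set es = A"
proof -
  have finA: "finite A" using G A(1) finite_subset unfolding multigraph_def by blast
  define P where "P = (\<lambda>(vs, es). closed_trail G vs es \<and> set es \<subseteq> A)"
  obtain v0 where "v0 \<in> verts G" using A(2) by blast
  then have start: "P ([v0], [])" unfolding P_def closed_trail_def by (simp add: walk_Nil)
  have "\<exists>t. P t \<and> (\<forall>t'. P t' \<longrightarrow> length (snd t') \<le> length (snd t))"
    by (rule ex_has_greatest_nat[where P = P and b = "Suc (card A)", OF start])
      (use length_trail_le[OF finA] in \<open>auto simp: P_def closed_trail_def less_Suc_eq_le\<close>)
  then obtain vs es where P: "P (vs, es)" and max: "\<And>vs' es'. P (vs', es') \<Longrightarrow> length es' \<le> length es"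
    by auto
  have t: "walk G vs es" "distinct es" "hd vs = last vs" "set es \<subseteq> A" "closed_trail G vs es"
    using P unfolding P_def closed_trail_def by auto
  have sat: "d \<in> set es" if d: "d \<in> A" "ends G d \<inter> set vs \<noteq> {}" for d
  proof (rule ccontr)
    assume "d \<notin> set es"
    obtain w where w: "w \<in> ends G d" "w \<in> set vs" using d(2) by auto
    have "\<not> odd_at (ends G) (A - set es) v" for v
      using odd_at_Un[of "A - set es" "set es" "ends G" v] finA spec[OF even, of v] closed_trail_even[OF G t(5)]
        t(4) by (auto simp: Un_absorb2)
    then obtain cs fs where c: "closed_trail G cs fs" "set fs \<subseteq> A - set es" "fs \<noteq> []" "hd cs = w"
      using closed_trail_through_edge[OF G, of "A - set es" d w] A(1) d(1) w(1) \<open>d \<notin> set es\<close> by blast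
    obtain vs1 es1 vs2 es2 where s: "es = es1 @ es2" "walk G vs1 es1" "walk G vs2 es2"
        "hd vs1 = hd vs" "last vs1 = w" "hd vs2 = w" "last vs2 = last vs"
      by (rule walk_split[OF t(1) w(2)])
    have c': "walk G cs fs" "distinct fs" "last cs = w" using c unfolding closed_trail_def by auto
    have ne: "vs1 \<noteq> []" "vs2 \<noteq> []" "cs \<noteq> []" using walk_nonempty s c' by auto
    have w1: "walk G (vs1 @ tl cs) (es1 @ fs)" using walk_append[OF s(2) c'(1)] s c by simp
    have l1: "last (vs1 @ tl cs) = w" using s(5) c'(3) c(4) ne
      by (cases cs) (auto simp: last_append split: if_splits)
    have w2: "walk G ((vs1 @ tl cs) @ tl vs2) ((es1 @ fs) @ es2)"
      using walk_append[OF w1 s(3)] l1 s(6) by simp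
    have "last ((vs1 @ tl cs) @ tl vs2) = last vs"
      using s(6,7) l1 ne by (cases vs2) (auto simp: last_append)
    moreover have "hd ((vs1 @ tl cs) @ tl vs2) = hd vs" using s(4) ne by simp
    moreover have "distinct ((es1 @ fs) @ es2)" "set ((es1 @ fs) @ es2) \<subseteq> A"
      using t s(1) c(2) c'(2) by auto
    ultimately have "P ((vs1 @ tl cs) @ tl vs2, (es1 @ fs) @ es2)"
      unfolding P_def closed_trail_def using w2 t(3) by auto
    then show False
      using max[of "(vs1 @ tl cs) @ tl vs2" "(es1 @ fs) @ es2"] c(3) s(1) by simp
  qed
  have hd: "hd vs \<in> set vs" using walk_nonempty[OF t(1)] by simp
  have verts: "v \<in> set vs" if "v \<in> verts G" for v
  proof -
    have c: "(hd vs, v) \<in> conn (ends G) A" 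
      using conn walk_hd_last(1)[OF t(1)] that unfolding connects_def by blast
    show ?thesis
    proof (rule verts_subset_of_saturated_walk[OF t(1) hd c])
      fix d assume "d \<in> A" "ends G d \<inter> set vs \<noteq> {}"
      then show "d \<in> set es" by (rule sat)
    qed
  qed
  have "A \<subseteq> set es"
  proof
    fix d assume d: "d \<in> A"
    then have "d \<in> edges G" using A(1) by blast
    then have "ends G d \<subseteq> verts G" "card (ends G d) = 2" using G unfolding multigraph_def by simp_all
    moreover from this have "ends G d \<noteq> {}" by auto
    ultimately show "d \<in> set es" using sat[OF d] verts by blast
  qed
  then show ?thesis
    using that[of vs es] t(4,5) subsetI[of "verts G" "set vs", OF verts] walk_set_verts[OF t(1)]
    unfolding spanning_closed_trail_def by simp
qed

section \<open>Bounded closed trails as connected even edge sets\<close>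

lemma has_bounded_spanning_closed_trailI:
  assumes G: "multigraph G" and A: "A \<subseteq> edges G" "verts G \<noteq> {}"
    and conn: "connects (ends G) A (verts G)" and even: "\<forall>v. \<not> odd_at (ends G) A v"
    and deg: "\<forall>v\<in>S. card {e \<in> A. v \<in> ends G e} \<le> 2 * f v" "\<forall>v\<in>S. 0 < f v"
  shows "has_bounded_spanning_closed_trail G S f"
proof -
  obtain vs es where t: "spanning_closed_trail G vs es" "set es = A"
    using euler_trail[OF G A conn even] by blast
  have "passes vs v \<le> f v" if "v \<in> S" for v
  proof (cases "length vs = 1")
    case True
    \<comment> \<open>The one-vertex trail makes one pass without using an edge, so the degree bound
      says nothing here and positivity of \<open>f\<close> takes over.\<close>
    then have "passes vs v \<le> 1" unfolding passes_def using count_le_length[of vs v] by simp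
    then show ?thesis using deg(2) that by force
  next
    case False
    then show ?thesis
      using closed_trail_degree[OF G, of vs es v] t bspec[OF deg(1) that]
      unfolding passes_def spanning_closed_trail_def by simp
  qed
  then show ?thesis using t unfolding has_bounded_spanning_closed_trail_def by blast
qed

lemma has_bounded_spanning_closed_trailE:
  assumes G: "multigraph G" and "has_bounded_spanning_closed_trail G S f"
  obtains A where "A \<subseteq> edges G" "connects (ends G) A (verts G)" "\<forall>v. \<not> odd_at (ends G) A v"
    "\<forall>v\<in>S. card {e \<in> A. v \<in> ends G e} \<le> 2 * f v"
proof -
  obtain vs es where t: "closed_trail G vs es" "set vs = verts G" "\<And>v. v \<in> S \<Longrightarrow> passes vs v \<le> f v"
    using assms(2) unfolding has_bounded_spanning_closed_trail_def spanning_closed_trail_def by blast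
  have w: "walk G vs es" using t(1) unfolding closed_trail_def by simp
  have "card {e \<in> set es. v \<in> ends G e} \<le> 2 * f v" if "v \<in> S" for v
  proof -
    \<comment> \<open>Only an inequality: for the one-vertex trail the left side is 0, whereas
      \<open>passes\<close> counts its vertex once.\<close>
    have "count_list (tl vs) v \<le> passes vs v"
      unfolding passes_def by (cases vs) auto
    then show ?thesis using closed_trail_degree[OF G t(1), of v] t(3)[OF that] by simp
  qed
  moreover have "connects (ends G) (set es) (verts G)"
    by (rule connectsI[of _ "hd vs"]) (use walk_conn[OF w] t(2) in simp)
  ultimately show ?thesis
    using that[of "set es"] walk_set_edges[OF w] closed_trail_even[OF G t(1)] by blast
qed

section \<open>Tree-connected components\<close>

lemma connected_spanning_subgraph_iff:
  assumes "\<And>e. e \<in> A \<Longrightarrow> ends G e \<subseteq> verts G"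
  shows "connected_graph (spanning_subgraph G A) \<longleftrightarrow> verts G \<noteq> {} \<and> connects (ends G) A (verts G)"
proof -
  let ?H = "spanning_subgraph G A"
  have H: "verts ?H = verts G" "edges ?H = A" "ends ?H = ends G"
    unfolding spanning_subgraph_def by simp_all
  have "(\<exists>vs es. walk ?H vs es \<and> hd vs = u \<and> last vs = v) \<longleftrightarrow> (u, v) \<in> conn (ends G) A"
    if "u \<in> verts G" for u v
  proof
    assume "\<exists>vs es. walk ?H vs es \<and> hd vs = u \<and> last vs = v"
    then obtain vs es where w: "walk ?H vs es" "hd vs = u" "last vs = v" by blast
    have "(hd vs, last vs) \<in> conn (ends G) (set es)"
      using walk_conn[OF w(1), of "last vs"] walk_nonempty[OF w(1)] H by simp
    then show "(u, v) \<in> conn (ends G) A"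
      using conn_mono[of "set es" A "ends G"] walk_set_edges[OF w(1)] w(2,3) H by auto
  next
    assume "(u, v) \<in> conn (ends G) A"
    then show "\<exists>vs es. walk ?H vs es \<and> hd vs = u \<and> last vs = v"
      using conn_walk[of A ?H u v] assms that H by simp
  qed
  then show ?thesis unfolding connected_graph_def connects_def H by auto
qed

text \<open>A connecting subset of \<open>A\<close> of least size has no cycle: an edge of a cycle
  could be dropped, as the rest of the cycle joins its ends.\<close>

lemma spanning_tree_exists:
  assumes G: "multigraph G" and A: "A \<subseteq> edges G" "verts G \<noteq> {}" "connects (ends G) A (verts G)"
  shows "\<exists>T\<subseteq>A. spanning_tree G T"
proof -
  have ends: "ends G e \<subseteq> verts G" if "e \<in> edges G" for e
    using G that unfolding multigraph_def by simp
  define P where "P = (\<lambda>T. T \<subseteq> A \<and> connects (ends G) T (verts G))"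
  have "P A" unfolding P_def using A by simp
  then obtain T where T: "P T" and min: "\<And>T'. P T' \<Longrightarrow> card T \<le> card T'"
    using ex_has_least_nat[where P = P and m = card] by blast
  have TG: "T \<subseteq> edges G" using T A(1) unfolding P_def by blast
  have finT: "finite T" using G TG finite_subset unfolding multigraph_def by blast
  let ?H = "spanning_subgraph G T"
  have H: "verts ?H = verts G" "edges ?H = T" "ends ?H = ends G"
    unfolding spanning_subgraph_def by simp_all
  have "\<not> cycle ?H vs es" for vs es
  proof
    assume c: "cycle ?H vs es"
    then have c: "walk ?H vs es" "distinct es" "hd vs = last vs" "es \<noteq> []"
      unfolding cycle_def closed_trail_def by simp_all
    then obtain d ds where es: "es = d # ds" by (cases es) auto
    obtain u ws where w: "vs = u # ws" "d \<in> T" "ends G d = {u, hd ws}" "walk ?H ws ds"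
      using c(1) unfolding es walk_Cons H by blast
    have ne: "ws \<noteq> []" using walk_nonempty[OF w(4)] .
    then have "last ws = u" using c(3) w(1) by simp
    then have "(hd ws, u) \<in> conn (ends G) (set ds)"
      using walk_conn[OF w(4), of "last ws"] last_in_set[OF ne] H by simp
    moreover have "set ds \<subseteq> T - {d}" using walk_set_edges[OF w(4)] c(2) H unfolding es by auto
    ultimately have hu: "(hd ws, u) \<in> conn (ends G) (T - {d})"
      using conn_mono[of "set ds" "T - {d}" "ends G"] by auto
    have "conn (ends G) T \<subseteq> conn (ends G) (T - {d})"
    proof (rule conn_replace)
      fix e x y assume e: "e \<in> T" "ends G e = {x, y}"
      show "(x, y) \<in> conn (ends G) (T - {d})"
      proof (cases "e = d")
        case True
        then have "x = u \<and> y = hd ws \<or> x = hd ws \<and> y = u"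
          using e(2) w(3) by (auto simp: doubleton_eq_iff)
        then show ?thesis using hu conn_sym[OF hu] by auto
      next
        case False
        then show ?thesis using e conn_edge[of e "T - {d}" "ends G" x y] by simp
      qed
    qed
    then have "P (T - {d})" using T unfolding P_def connects_def by blast
    then have "card T \<le> card (T - {d})" by (rule min)
    then show False using w(2) finT card_Diff1_less[of T d] by simp
  qed
  moreover have "connected_graph ?H"
    using connected_spanning_subgraph_iff[of T G] ends TG A(2) T unfolding P_def by auto
  ultimately have "spanning_tree G T" unfolding spanning_tree_def tree_def using TG by blast
  then show ?thesis using T unfolding P_def by blast
qed

text \<open>A spanning tree connects, and a connecting edge set contains a spanning tree, so
  packings can be handled as families of disjoint connecting sets.\<close>

lemma tree_connected_iff:
  assumes G: "multigraph G"
  shows "tree_connected m G \<longleftrightarrow> verts G \<noteq> {} \<and>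
    (\<exists>C. (\<forall>i<m. C i \<subseteq> edges G \<and> connects (ends G) (C i) (verts G)) \<and> disjoint_family_on C {..<m})"
proof
  have ends: "ends G e \<subseteq> verts G" if "e \<in> edges G" for e
    using G that unfolding multigraph_def by simp
  assume "tree_connected m G"
  then obtain T where T: "verts G \<noteq> {}" "\<forall>i<m. spanning_tree G (T i)" "disjoint_family_on T {..<m}"
    unfolding tree_connected_def by blast
  have "T i \<subseteq> edges G \<and> connects (ends G) (T i) (verts G)" if "i < m" for i
  proof -
    have "T i \<subseteq> edges G" "connected_graph (spanning_subgraph G (T i))"
      using T(2) that unfolding spanning_tree_def tree_def by auto
    then show ?thesis using connected_spanning_subgraph_iff[of "T i" G] ends by auto
  qed
  then show "verts G \<noteq> {} \<and>
    (\<exists>C. (\<forall>i<m. C i \<subseteq> edges G \<and> connects (ends G) (C i) (verts G)) \<and> disjoint_family_on C {..<m})"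
    using T by blast
next
  assume R: "verts G \<noteq> {} \<and>
    (\<exists>C. (\<forall>i<m. C i \<subseteq> edges G \<and> connects (ends G) (C i) (verts G)) \<and> disjoint_family_on C {..<m})"
  then obtain C where C: "\<And>i. i < m \<Longrightarrow> C i \<subseteq> edges G \<and> connects (ends G) (C i) (verts G)"
      "disjoint_family_on C {..<m}"
    by blast
  have "\<forall>i. \<exists>T. i < m \<longrightarrow> T \<subseteq> C i \<and> spanning_tree G T"
    using spanning_tree_exists[OF G] C(1) R by meson
  then obtain T where T: "\<And>i. i < m \<Longrightarrow> T i \<subseteq> C i \<and> spanning_tree G (T i)" by metis
  have "T i \<inter> T j = {}" if "i < m" "j < m" "i \<noteq> j" for i j
  proof -
    have "C i \<inter> C j = {}" using C(2) that unfolding disjoint_family_on_def by simp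
    then show ?thesis using T[OF that(1)] T[OF that(2)] by blast
  qed
  then have "disjoint_family_on T {..<m}" unfolding disjoint_family_on_def by simp
  then show "tree_connected m G" unfolding tree_connected_def using R T by blast
qed

lemma induced_subgraph_simps [simp]:
  "verts (induced_subgraph G W) = W" "ends (induced_subgraph G W) = ends G"
  "edges (induced_subgraph G W) = {e \<in> edges G. ends G e \<subseteq> W}"
  by (simp_all add: induced_subgraph_def)

lemma multigraph_induced_subgraph:
  "multigraph G \<Longrightarrow> W \<subseteq> verts G \<Longrightarrow> multigraph (induced_subgraph G W)"
  unfolding multigraph_def by (auto dest: finite_subset)

text \<open>A packing witness for the subgraph induced on \<open>W\<close>, phrased in
  \<open>G\<close> itself so that witnesses for different vertex sets can be combined within one
  graph.\<close>

definition joins :: "nat \<Rightarrow> ('v, 'e) mgraph \<Rightarrow> 'v set \<Rightarrow> (nat \<Rightarrow> 'e set) \<Rightarrow> bool" where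
  "joins m G W C \<longleftrightarrow> disjoint_family_on C {..<m} \<and>
     (\<forall>i<m. C i \<subseteq> edges G \<and> connects (ends G) (C i) W \<and> (\<forall>e\<in>C i. ends G e \<subseteq> W))"

lemma tree_connected_induced_iff:
  assumes "multigraph G" "W \<subseteq> verts G"
  shows "tree_connected m (induced_subgraph G W) \<longleftrightarrow> W \<noteq> {} \<and> (\<exists>C. joins m G W C)"
proof -
  have "B \<subseteq> {e \<in> edges G. ends G e \<subseteq> W} \<longleftrightarrow> B \<subseteq> edges G \<and> (\<forall>e\<in>B. ends G e \<subseteq> W)" for B
    by blast
  then show ?thesis
    unfolding tree_connected_iff[OF multigraph_induced_subgraph[OF assms]] joins_def
      induced_subgraph_simps by (auto simp: conj_commute conj_left_commute)
qed

text \<open>Edges of \<open>C' i\<close> inside \<open>W\<close> are discarded, since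
  \<open>C i\<close> already connects their ends. Those kept are not contained in \<open>W\<close>,
  unlike all edges of every \<open>C j\<close>, which secures disjointness.\<close>

lemma joins_Un:
  assumes C: "joins m G W C" and C': "joins m G W' C'" and x: "x \<in> W" "x \<in> W'"
  shows "joins m G (W \<union> W') (\<lambda>i. C i \<union> {e \<in> C' i. \<not> ends G e \<subseteq> W})"
proof -
  let ?C = "\<lambda>i. C i \<union> {e \<in> C' i. \<not> ends G e \<subseteq> W}"
  have "connects (ends G) (?C i) (W \<union> W')" if i: "i < m" for i
  proof (rule connectsI)
    fix u assume u: "u \<in> W \<union> W'"
    have c: "connects (ends G) (C i) W" "connects (ends G) (C' i) W'"
      using C C' i unfolding joins_def by simp_all
    have mono: "conn (ends G) (C i) \<subseteq> conn (ends G) (?C i)" by (rule conn_mono) blast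
    have "conn (ends G) (C' i) \<subseteq> conn (ends G) (?C i)"
    proof (rule conn_replace)
      fix e a b assume e: "e \<in> C' i" "ends G e = {a, b}"
      show "(a, b) \<in> conn (ends G) (?C i)"
      proof (cases "ends G e \<subseteq> W")
        case True
        then show ?thesis using c(1) e(2) mono unfolding connects_def by auto
      next
        case False
        then show ?thesis using e by (intro conn_edge[of e]) auto
      qed
    qed
    then show "(x, u) \<in> conn (ends G) (?C i)"
      using u c x mono unfolding connects_def by blast
  qed
  moreover have "?C i \<inter> ?C j = {}" if "i < m" "j < m" "i \<noteq> j" for i j
  proof -
    have "C i \<inter> C j = {}" "C' i \<inter> C' j = {}"
      using C C' that unfolding joins_def disjoint_family_on_def by simp_all
    moreover have "\<forall>e\<in>C i. ends G e \<subseteq> W" "\<forall>e\<in>C j. ends G e \<subseteq> W"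
      using C that unfolding joins_def by simp_all
    ultimately show ?thesis by blast
  qed
  moreover have "?C i \<subseteq> edges G \<and> (\<forall>e\<in>?C i. ends G e \<subseteq> W \<union> W')" if "i < m" for i
  proof -
    have "C i \<subseteq> edges G" "C' i \<subseteq> edges G" "\<forall>e\<in>C i. ends G e \<subseteq> W" "\<forall>e\<in>C' i. ends G e \<subseteq> W'"
      using C C' that unfolding joins_def by simp_all
    then show ?thesis by blast
  qed
  ultimately show ?thesis unfolding joins_def disjoint_family_on_def by simp
qed

section \<open>Maximal tree-connected vertex sets and \<open>Omega\<close>\<close>

context
  fixes G :: "('v, 'e) mgraph" and m :: nat and D :: "'v set set"
  assumes G: "multigraph G"
  defines "D \<equiv> tree_connected_components m G"
begin

lemma in_componentsD:
  assumes "W \<in> D"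
  shows "W \<subseteq> verts G" "W \<noteq> {}" "\<exists>C. joins m G W C"
proof -
  show "W \<subseteq> verts G" using assms unfolding D_def tree_connected_components_def by blast
  then have "W \<noteq> {} \<and> (\<exists>C. joins m G W C)"
    using assms tree_connected_induced_iff[OF G, of W m]
    unfolding D_def tree_connected_components_def by blast
  then show "W \<noteq> {}" "\<exists>C. joins m G W C" by blast+
qed

text \<open>Overlapping components would have a tree-connected union, against maximality.\<close>

lemma components_disjoint:
  assumes "W \<in> D" "W' \<in> D" "x \<in> W" "x \<in> W'"
  shows "W = W'"
proof -
  have U: "W \<union> W' \<subseteq> verts G" using in_componentsD(1) assms by blast
  obtain C C' where "joins m G W C" "joins m G W' C'" using in_componentsD(3) assms by metis
  then have "tree_connected m (induced_subgraph G (W \<union> W'))"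
    using joins_Un[of m G W C W' C' x] tree_connected_induced_iff[OF G U, of m] assms(3,4) by blast
  moreover have "\<not> tree_connected m (induced_subgraph G U)" if "V \<in> D" "V \<subset> U" "U \<subseteq> verts G" for U V
    using that unfolding D_def tree_connected_components_def by blast
  ultimately have "\<not> W \<subset> W \<union> W'" "\<not> W' \<subset> W \<union> W'" using assms(1,2) U by metis+
  then show ?thesis by blast
qed

lemma component_above:
  assumes "W0 \<subseteq> verts G" "tree_connected m (induced_subgraph G W0)"
  shows "\<exists>W\<in>D. W0 \<subseteq> W"
proof -
  have fin: "finite (verts G)" using G unfolding multigraph_def by simp
  define P where "P = (\<lambda>W. W0 \<subseteq> W \<and> W \<subseteq> verts G \<and> tree_connected m (induced_subgraph G W))"
  have "P W0" using assms unfolding P_def by simp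
  moreover have "\<forall>W. P W \<longrightarrow> card W < Suc (card (verts G))"
    unfolding P_def using fin by (simp add: card_mono less_Suc_eq_le)
  ultimately obtain W where W: "P W" and max: "\<And>W'. P W' \<Longrightarrow> card W' \<le> card W"
    using ex_has_greatest_nat[where P = P and f = card and b = "Suc (card (verts G))" and k = W0] by blast
  have "\<not> tree_connected m (induced_subgraph G W')" if W': "W \<subset> W'" "W' \<subseteq> verts G" for W'
  proof
    assume "tree_connected m (induced_subgraph G W')"
    then have "P W'" using W W' unfolding P_def by blast
    moreover have "card W < card W'" using W' fin by (meson finite_subset psubset_card_mono)
    ultimately show False using max[of W'] by simp
  qed
  then have "W \<in> D" using W unfolding P_def D_def tree_connected_components_def by blast
  then show ?thesis using W unfolding P_def by blast
qed

lemma in_some_component: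
  assumes "v \<in> verts G"
  shows "\<exists>W\<in>D. v \<in> W"
proof -
  have "joins m G {v} (\<lambda>_. {})"
    unfolding joins_def connects_def disjoint_family_on_def by simp
  then have "tree_connected m (induced_subgraph G {v})"
    using tree_connected_induced_iff[OF G, of "{v}" m] assms by auto
  then show ?thesis using component_above[of "{v}"] assms by auto
qed

text \<open>The packings inside the components combine to \<open>m\<close> disjoint sets
  \<open>Q i\<close> that avoid the crossing edges and have rank at least
  \<open>card (verts G) - card D\<close>. Their rank beyond that of \<open>A\<close> is paid for by
  edges outside \<open>A\<close>; \<open>card D\<close> and the crossing edges then make up
  \<open>Omega\<close>. The set \<open>V\<close> may exceed \<open>verts G\<close> so that one rank
  function serves before and after vertices are deleted.\<close>

lemma Omega_rank_bound:
  assumes V: "finite V" "verts G \<subseteq> V" and A: "A \<subseteq> edges G"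
    and inside: "\<And>e. e \<in> A \<Longrightarrow> \<exists>W\<subseteq>verts G. ends G e \<subseteq> W \<and> tree_connected m (induced_subgraph G W)"
  shows "int m * int (card (verts G))
    \<le> Omega m G + int m * int (graphic_rank (ends G) V A) + int (card (edges G - A))"
proof -
  let ?r = "graphic_rank (ends G) V"
  have fin: "finite (verts G)" "finite (edges G)"
    and ends: "\<And>e. e \<in> edges G \<Longrightarrow> ends G e \<subseteq> verts G \<and> card (ends G e) = 2"
    using G unfolding multigraph_def by simp_all
  have r: "rank_function (edges G) ?r"
    by (rule rank_function_graphic) (use V fin ends in auto)
  have "D \<subseteq> Pow (verts G)" using in_componentsD(1) by blast
  then have finD: "finite D" using fin finite_subset by blast
  have "\<forall>W. \<exists>C. W \<in> D \<longrightarrow> joins m G W C" using in_componentsD(3) by blast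
  then obtain C where C: "\<And>W. W \<in> D \<Longrightarrow> joins m G W (C W)" by metis
  define Q where "Q = (\<lambda>i. \<Union>W\<in>D. C W i)"
  have inQ: "\<exists>W\<in>D. e \<in> C W i \<and> ends G e \<subseteq> W \<and> e \<in> edges G" if "e \<in> Q i" "i < m" for e i
    using that C unfolding Q_def joins_def by blast
  have same: "W = W'" if "W \<in> D" "W' \<in> D" "ends G e \<inter> W \<noteq> {}" "ends G e \<subseteq> W'" for W W' e
    using components_disjoint[OF that(1,2)] that(3,4) by blast
  have Q_edges: "Q i \<subseteq> edges G" if "i < m" for i using inQ that by blast
  have Q_disj: "Q i \<inter> Q j = {}" if ij: "i < m" "j < m" "i \<noteq> j" for i j
  proof (rule ccontr)
    assume "Q i \<inter> Q j \<noteq> {}"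
    then obtain e where "e \<in> Q i" "e \<in> Q j" by blast
    then obtain W W' where W: "W \<in> D" "e \<in> C W i" "ends G e \<subseteq> W" "e \<in> edges G"
        "W' \<in> D" "e \<in> C W' j" "ends G e \<subseteq> W'"
      using inQ ij by meson
    have "ends G e \<noteq> {}" using ends[OF W(4)] by auto
    then have "W = W'" using same[OF W(1,5)] W(3,7) by blast
    then show False
      using C[OF W(1)] W(2,6) ij unfolding joins_def disjoint_family_on_def by blast
  qed
  define X where "X = crossing_edges G D"
  have X_edges: "X \<subseteq> edges G" unfolding X_def crossing_edges_def by blast
  have not_crossing: "e \<notin> X" if "W \<in> D" "ends G e \<subseteq> W" for e W
    using same that unfolding X_def crossing_edges_def by blast
  have QX: "Q i \<inter> X = {}" if "i < m" for i using inQ not_crossing that by blast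
  \<comment> \<open>A tree-connected set around an edge extends to a component, so the edge cannot
    cross.\<close>
  have AX: "A \<inter> X = {}"
  proof (rule ccontr)
    assume "A \<inter> X \<noteq> {}"
    then obtain e where e: "e \<in> A" "e \<in> X" by blast
    obtain W0 where W0: "W0 \<subseteq> verts G" "ends G e \<subseteq> W0" "tree_connected m (induced_subgraph G W0)"
      using inside[OF e(1)] by blast
    obtain W where "W \<in> D" "ends G e \<subseteq> W" using component_above[OF W0(1,3)] W0(2) by blast
    then show False using not_crossing[of W e] e(2) by blast
  qed
  \<comment> \<open>Each component lies in one class of \<open>Q i\<close>, which leaves at most
    \<open>card D\<close> classes on \<open>verts G\<close>. A vertex of \<open>V - verts G\<close>
    adds one to \<open>card V\<close> and at most one class, so it does not lower the rank.\<close>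
  have rank: "card (verts G) \<le> ?r (Q i) + card D" if i: "i < m" for i
  proof -
    let ?c = "component (ends G) (Q i)"
    have "?c ` verts G \<subseteq> (\<lambda>W. ?c (SOME x. x \<in> W)) ` D"
    proof (rule image_subsetI)
      fix v assume "v \<in> verts G"
      then obtain W where W: "W \<in> D" "v \<in> W" using in_some_component[of v] by blast
      have "(SOME x. x \<in> W) \<in> W" using W(2) by (rule someI)
      moreover have "connects (ends G) (C W i) W" using C[OF W(1)] i unfolding joins_def by simp
      ultimately have "(v, SOME x. x \<in> W) \<in> conn (ends G) (C W i)"
        using W(2) unfolding connects_def by blast
      moreover have "conn (ends G) (C W i) \<subseteq> conn (ends G) (Q i)"
        by (rule conn_mono) (use W(1) in \<open>auto simp: Q_def\<close>)
      ultimately have "?c v = ?c (SOME x. x \<in> W)" unfolding component_eq_iff by (rule subsetD[rotated])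
      then show "?c v \<in> (\<lambda>W. ?c (SOME x. x \<in> W)) ` D" using W(1) by (rule image_eqI)
    qed
    then have "card (?c ` verts G) \<le> card D"
      using finD by (meson card_image_le card_mono finite_imageI le_trans)
    moreover have "?c ` V = ?c ` verts G \<union> ?c ` (V - verts G)" using V(2) by blast
    then have "card (?c ` V) \<le> card (?c ` verts G) + card (?c ` (V - verts G))"
      using card_Un_le[of "?c ` verts G" "?c ` (V - verts G)"] by simp
    moreover have "card (?c ` (V - verts G)) \<le> card (V - verts G)"
      using V(1) by (intro card_image_le) simp
    moreover have "card V = card (verts G) + card (V - verts G)"
      using V fin(1) by (simp add: card_Diff_subset card_mono)
    ultimately show ?thesis unfolding graphic_rank_def by simp
  qed
  have finQ: "finite (Q i)" if "i < m" for i using Q_edges[OF that] fin(2) by (rule finite_subset)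
  have "m * card (verts G) = (\<Sum>i<m. card (verts G))" by simp
  also have "\<dots> \<le> (\<Sum>i<m. ?r A + card (Q i - A) + card D)"
  proof (rule sum_mono)
    fix i assume "i \<in> {..<m}"
    then have i: "i < m" by simp
    show "card (verts G) \<le> ?r A + card (Q i - A) + card D"
      using rank[OF i] rank_function_le_diff[OF r A Q_edges[OF i]] by simp
  qed
  also have "\<dots> = m * ?r A + (\<Sum>i<m. card (Q i - A)) + m * card D"
    by (simp add: sum.distrib)
  also have "(\<Sum>i<m. card (Q i - A)) = card (\<Union>i<m. Q i - A)"
  proof (rule card_UN_disjoint[symmetric])
    show "\<forall>i\<in>{..<m}. \<forall>j\<in>{..<m}. i \<noteq> j \<longrightarrow> (Q i - A) \<inter> (Q j - A) = {}"
      using Q_disj by blast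
  qed (use finQ in auto)
  also have "card (\<Union>i<m. Q i - A) \<le> card (edges G - A - X)"
    by (rule card_mono) (use fin(2) Q_edges QX in blast)+
  also have "card (edges G - A - X) = card (edges G - A) - card X"
    by (rule card_Diff_subset) (use X_edges AX fin(2) finite_subset in blast)+
  finally have "m * card (verts G) \<le> m * ?r A + (card (edges G - A) - card X) + m * card D" by simp
  moreover have "card X \<le> card (edges G - A)"
    by (rule card_mono) (use X_edges AX fin(2) in blast)+
  ultimately have "m * card (verts G) + card X \<le> m * ?r A + card (edges G - A) + m * card D" by simp
  then have "int m * int (card (verts G)) + int (card X)
      \<le> int m * int (?r A) + int (card (edges G - A)) + int m * int (card D)"
    by (metis of_nat_add of_nat_le_iff of_nat_mult)
  then show ?thesis unfolding Omega_def Let_def X_def D_def by simp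
qed

end

text \<open>Every \<open>C i\<close> has the same classes as \<open>A\<close>, so its walks from
  \<open>u\<close> stay in the class of \<open>u\<close> and its edges inside that class connect it.
  Applied to the forests within the dual set, this yields the tree-connected sets around edges of
  \<open>A\<close> that the bound on \<open>Omega\<close> asks for.\<close>

lemma component_tree_connected:
  assumes H: "multigraph H" and u: "u \<in> verts H" and A: "A \<subseteq> edges H"
    and C: "disjoint_family_on C {..<m}" "\<And>i. i < m \<Longrightarrow> C i \<subseteq> A"
      "\<And>i. i < m \<Longrightarrow> conn (ends H) (C i) = conn (ends H) A"
  shows "component (ends H) A u \<subseteq> verts H"
    and "tree_connected m (induced_subgraph H (component (ends H) A u))"
proof -
  let ?W = "component (ends H) A u"
  have ends: "ends H e \<subseteq> verts H" if "e \<in> A" for e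
    using H A that unfolding multigraph_def by blast
  show sub: "?W \<subseteq> verts H"
  proof
    fix x assume "x \<in> ?W"
    then have "(u, x) \<in> (adj (ends H) A)\<^sup>*" unfolding component_def conn_def by simp
    then show "x \<in> verts H"
      using u by (induction rule: rtrancl_induct) (use ends in \<open>auto simp: adj_def\<close>)
  qed
  let ?C = "\<lambda>i. {e \<in> C i. ends H e \<subseteq> ?W}"
  have "connects (ends H) (?C i) ?W" if i: "i < m" for i
  proof (rule connectsI)
    fix x assume "x \<in> ?W"
    then have "(u, x) \<in> (adj (ends H) (C i))\<^sup>*"
      using C(3)[OF i] unfolding component_def conn_def by simp
    then show "(u, x) \<in> conn (ends H) (?C i)"
    proof (induction rule: rtrancl_induct)
      case base
      show ?case by simp
    next
      case (step y z)
      obtain e where e: "e \<in> C i" "ends H e = {y, z}" using step.hyps(2) unfolding adj_def by auto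
      have uy: "(u, y) \<in> conn (ends H) A"
        using step.hyps(1) C(3)[OF i] unfolding conn_def by simp
      moreover have "(y, z) \<in> conn (ends H) A"
        using conn_edge[where en = "ends H", OF e] C(3)[OF i] by simp
      ultimately have "(u, z) \<in> conn (ends H) A" by (rule conn_trans)
      then have "e \<in> ?C i" using uy e unfolding component_def by simp
      then show ?case using conn_trans[OF step.IH conn_edge[where en = "ends H", OF _ e(2)]] by blast
    qed
  qed
  moreover have "disjoint_family_on ?C {..<m}"
    using C(1) unfolding disjoint_family_on_def by blast
  moreover have "?C i \<subseteq> edges H" if "i < m" for i using C(2)[OF that] A by blast
  ultimately have "joins m H ?W ?C" unfolding joins_def by simp
  moreover have "u \<in> ?W" unfolding component_def by simp
  ultimately show "tree_connected m (induced_subgraph H ?W)"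
    using tree_connected_induced_iff[OF H sub, of m] by blast
qed

text \<open>Exchanging \<open>Q \<inter> A\<close> for \<open>F0 \<inter> A\<close> changes parities
  by a set of edges in \<open>A\<close>; since \<open>F1 \<inter> A\<close> spans \<open>A\<close>,
  it contains a join \<open>J\<close> that repairs them. With \<open>Q = {}\<close> and
  \<open>A = E\<close> this is the parity correction of a spanning tree.\<close>

lemma reroute:
  assumes fin: "finite E" and E: "\<And>e. e \<in> E \<Longrightarrow> card (en e) = 2"
    and sub: "Q \<subseteq> E" "F0 \<subseteq> E" "F1 \<subseteq> E" "A \<subseteq> E" "F0 \<inter> F1 = {}"
    and span: "conn en A \<subseteq> conn en (F1 \<inter> A)"
    and even: "\<forall>v. \<not> odd_at en Q v"
  obtains J where "J \<subseteq> F1 \<inter> A" "\<forall>v. \<not> odd_at en ((Q - A) \<union> (F0 \<inter> A) \<union> J) v"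
proof -
  let ?K = "(Q \<inter> A) - (F0 \<inter> A) \<union> ((F0 \<inter> A) - (Q \<inter> A))"
  have finite: "finite B" if "B \<subseteq> E" for B using fin that finite_subset by blast
  have KA: "?K \<subseteq> A" by blast
  have "\<exists>J\<subseteq>F1 \<inter> A. \<forall>v. odd_at en J v \<longleftrightarrow> odd_at en ?K v"
  proof (rule odd_at_join)
    show "finite (F1 \<inter> A)" "finite ?K" by (rule finite, use sub in blast)+
    show "card (en e) = 2" if "e \<in> F1 \<inter> A" for e using that sub E by blast
    show "card (en e) = 2" if "e \<in> ?K" for e using that sub E by blast
    show "(u, v) \<in> conn en (F1 \<inter> A)" if "e \<in> ?K" "en e = {u, v}" for e u v
      using conn_edge[of e A en u v] that KA span by blast
  qed
  then obtain J where J: "J \<subseteq> F1 \<inter> A" "\<And>v. odd_at en J v \<longleftrightarrow> odd_at en ?K v" by blast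
  have fins: "finite (Q - A)" "finite (Q \<inter> A)" "finite (F0 \<inter> A)" "finite J"
    by (rule finite, use sub J(1) in blast)+
  have "\<not> odd_at en ((Q - A) \<union> (F0 \<inter> A) \<union> J) v" for v
  proof -
    have "odd_at en ((Q - A) \<union> (F0 \<inter> A) \<union> J) v \<longleftrightarrow> odd_at en ((Q - A) \<union> (F0 \<inter> A)) v \<noteq> odd_at en J v"
      by (intro odd_at_Un finite_UnI fins) (use sub J(1) in blast)
    moreover have "odd_at en ((Q - A) \<union> (F0 \<inter> A)) v \<longleftrightarrow> odd_at en (Q - A) v \<noteq> odd_at en (F0 \<inter> A) v"
      by (intro odd_at_Un fins) blast
    moreover have "odd_at en ?K v \<longleftrightarrow> odd_at en (Q \<inter> A) v \<noteq> odd_at en (F0 \<inter> A) v"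
      by (intro odd_at_symdiff fins)
    moreover have "odd_at en ((Q - A) \<union> (Q \<inter> A)) v \<longleftrightarrow> odd_at en (Q - A) v \<noteq> odd_at en (Q \<inter> A) v"
      by (intro odd_at_Un fins) blast
    moreover have "(Q - A) \<union> (Q \<inter> A) = Q" by blast
    ultimately show ?thesis using J(2)[of v] spec[OF even, of v] by auto
  qed
  then show ?thesis using that J(1) by blast
qed

section \<open>Bounded spanning closed trails\<close>

theorem theorem7p5:
  fixes G :: "('v, 'e) mgraph" and X :: "'v set" and f :: "'v \<Rightarrow> nat"
  assumes "multigraph G"
    and "tree_connected 2 G"
    and "X \<subseteq> verts G"
    and "independent_set G X"
    and "\<forall>v\<in>X. f v > 0"
    and "\<forall>S. S \<subseteq> X \<longrightarrow>
           has_bounded_spanning_closed_trail G S f \<or>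
           (1 / 2) * real_of_int (Omega 2 (delete_verts G S))
             \<le> (\<Sum>v\<in>S. (real (f v) - 1 / 2)) + 1"
  shows "has_bounded_spanning_closed_trail G X f"
proof -
  note G = assms(1)
  let ?E = "edges G" and ?V = "verts G" and ?en = "ends G"
  let ?r = "graphic_rank ?en ?V"
  have finV: "finite ?V" and finE: "finite ?E"
    and ends: "\<And>e. e \<in> ?E \<Longrightarrow> ?en e \<subseteq> ?V \<and> card (?en e) = 2"
    using G unfolding multigraph_def by simp_all
  have card2: "card (?en e) = 2" if "e \<in> ?E" for e using ends[OF that] by blast
  have V_ne: "?V \<noteq> {}" using assms(2) unfolding tree_connected_def by simp
  have finX: "finite X" using assms(3) finV by (rule finite_subset)
  have r: "rank_function ?E ?r" by (rule rank_function_graphic) (use finV finE ends in auto)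
  have one_end: "u = v" if "e \<in> ?E" "u \<in> ?en e" "v \<in> ?en e" "u \<in> X" "v \<in> X" for e u v
  proof (rule ccontr)
    assume "u \<noteq> v"
    then have "?en e = {u, v}" using ends[OF that(1)] that(2,3) by (auto simp: card_2_iff)
    then show False using assms(4) that unfolding independent_set_def by blast
  qed
  \<comment> \<open>By independence of \<open>X\<close> an edge has at most one end there, so its
    class is \<open>{}\<close> or a single vertex.\<close>
  define \<kappa> where "\<kappa> = (\<lambda>e. ?en e \<inter> X)"
  \<comment> \<open>\<open>card ?E\<close> imposes no restriction on the edges that avoid
    \<open>X\<close>. On a singleton the sum is just \<open>2 * f v + 1\<close>; writing a sum
    avoids extracting the element of \<open>c\<close>.\<close>
  define cap where "cap = (\<lambda>c. if c = {} then card ?E else (\<Sum>v\<in>c. 2 * f v + 1))"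
  have \<kappa>: "\<kappa> e = {v} \<longleftrightarrow> v \<in> ?en e" if "e \<in> ?E" "v \<in> X" for e v
    using one_end[OF that(1)] that(2) unfolding \<kappa>_def by blast
  have classes: "\<kappa> ` ?E \<subseteq> insert {} ((\<lambda>v. {v}) ` X)"
  proof (rule image_subsetI)
    fix e assume e: "e \<in> ?E"
    show "\<kappa> e \<in> insert {} ((\<lambda>v. {v}) ` X)"
    proof (cases "\<kappa> e = {}")
      case False
      then obtain v where "v \<in> X" "v \<in> ?en e" unfolding \<kappa>_def by blast
      then show ?thesis using \<kappa>[OF e, of v] by simp
    qed simp
  qed
  have "finite (insert {} ((\<lambda>v. {v}) ` X))" using finX by simp
  then obtain A F where A: "A \<subseteq> ?E"
    and F: "\<forall>i<2. F i \<subseteq> ?E \<and> ?r (F i) = card (F i) \<and> ?r (F i \<inter> A) = ?r A"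
      "disjoint_family_on F {..<2::nat}"
    and F_cap: "\<forall>c\<in>insert {} ((\<lambda>v. {v}) ` X). card {e \<in> \<Union>(F ` {..<2}). \<kappa> e = c} \<le> cap c"
    and F_out: "\<forall>c\<in>insert {} ((\<lambda>v. {v}) ` X). card {e \<in> \<Union>(F ` {..<2}) - A. \<kappa> e = c}
      = min (cap c) (card {e \<in> ?E - A. \<kappa> e = c})"
    by (rule capacitated_packing[OF r _ classes, where m = 2 and cap = cap])
  have F_E: "F i \<subseteq> ?E" and F_ind: "?r (F i) = card (F i)" and F_A: "?r (F i \<inter> A) = ?r A"
    if "i < 2" for i
    using F(1) that by blast+
  define U where "U = F 0 \<union> F 1"
  have "{..<2::nat} = {0, 1}" by auto
  then have U: "\<Union>(F ` {..<2}) = U" unfolding U_def by simp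
  have F01: "F 0 \<subseteq> ?E" "F 1 \<subseteq> ?E" using F_E by simp_all
  have F_disj: "F 0 \<inter> F 1 = {}" using F(2) unfolding disjoint_family_on_def by simp
  have UE: "U \<subseteq> ?E" using F01 unfolding U_def by blast
  have finU: "finite U" using UE finE by (rule finite_subset)
  have star: "{e \<in> B. \<kappa> e = {v}} = {e \<in> B. v \<in> ?en e}" if "B \<subseteq> ?E" "v \<in> X" for B v
    using \<kappa> that by blast
  have U_deg: "card {e \<in> U. v \<in> ?en e} \<le> 2 * f v + 1" if "v \<in> X" for v
    using bspec[OF F_cap, of "{v}"] star[OF UE that] that unfolding U cap_def by simp
  have UA: "U - A \<subseteq> ?E" "?E - A \<subseteq> ?E" using UE by blast+
  have U_out: "card {e \<in> U - A. v \<in> ?en e} = min (2 * f v + 1) (card {e \<in> ?E - A. v \<in> ?en e})"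
    if "v \<in> X" for v
    using bspec[OF F_out, of "{v}"] star[OF UA(1) that] star[OF UA(2) that] that
    unfolding U cap_def by simp
  \<comment> \<open>An edge at \<open>v\<close> left out of \<open>A\<close> and of both forests
    shows that the minimum in \<open>U_out\<close> is attained by the capacity.\<close>
  define T where "T = {v \<in> X. \<exists>e\<in>?E - A. v \<in> ?en e \<and> e \<notin> U}"
  have TX: "T \<subseteq> X" unfolding T_def by blast
  have finT: "finite T" using TX finX by (rule finite_subset)
  have T_out: "card {e \<in> U - A. v \<in> ?en e} = 2 * f v + 1" if v: "v \<in> T" for v
  proof -
    have "{e \<in> U - A. v \<in> ?en e} \<subset> {e \<in> ?E - A. v \<in> ?en e}"
      using v UE unfolding T_def by blast
    then have "card {e \<in> U - A. v \<in> ?en e} < card {e \<in> ?E - A. v \<in> ?en e}"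
      using finE by (intro psubset_card_mono) auto
    then show ?thesis using U_out[of v] v TX by auto
  qed
  have span: "conn ?en (F i \<inter> A) = conn ?en A" if "i < 2" for i
    by (rule conn_eq_of_graphic_rank_eq[OF finV finE ends A]) (use F_A[OF that] in auto)
  have T_A: "v \<notin> ?en e" if v: "v \<in> T" and e: "e \<in> A" for v e
  proof
    assume ve: "v \<in> ?en e"
    \<comment> \<open>Forest edges outside \<open>A\<close> already fill the capacity at
      \<open>v\<close>, so none inside \<open>A\<close> meets \<open>v\<close>. As
      \<open>F 0 \<inter> A\<close> spans \<open>A\<close>, it would have to meet every vertex that
      \<open>A\<close> meets.\<close>
    have "card {e \<in> U. v \<in> ?en e} \<le> card {e \<in> U - A. v \<in> ?en e}"
      using U_deg[of v] T_out[OF v] v TX by auto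
    then have "{e \<in> U - A. v \<in> ?en e} = {e \<in> U. v \<in> ?en e}"
      using finU by (intro card_seteq) auto
    then have no_edge: "v \<notin> ?en d" if "d \<in> F 0 \<inter> A" for d
      using that unfolding U_def by blast
    have "card (?en e) = 2" using ends A e by blast
    then have "\<exists>w. ?en e = {v, w} \<and> v \<noteq> w" using ve by (auto simp: card_2_iff doubleton_eq_iff)
    then obtain w where w: "?en e = {v, w}" "v \<noteq> w" by blast
    have "(v, w) \<in> conn ?en A" using e w(1) by (rule conn_edge)
    then have "(v, w) \<in> (adj ?en (F 0 \<inter> A))\<^sup>*" using span[of 0] unfolding conn_def by simp
    then obtain y where "(v, y) \<in> adj ?en (F 0 \<inter> A)" using w(2) by (meson converse_rtranclE)
    then show False using no_edge unfolding adj_def by auto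
  qed
  have T_free: "e \<in> U" if e: "e \<in> ?E - A" "?en e \<inter> T = {}" for e
  proof (cases "\<kappa> e = {}")
    case True
    \<comment> \<open>With capacity \<open>card ?E\<close> the minimum is the whole class, so both
      forests together contain it.\<close>
    have "card {e \<in> ?E - A. \<kappa> e = {}} \<le> card ?E" using finE by (intro card_mono) auto
    then have "card {e \<in> U - A. \<kappa> e = {}} = card {e \<in> ?E - A. \<kappa> e = {}}"
      using bspec[OF F_out, of "{}"] unfolding U cap_def by simp
    then have "{e \<in> U - A. \<kappa> e = {}} = {e \<in> ?E - A. \<kappa> e = {}}"
      using UE finE by (intro card_seteq) auto
    then show ?thesis using True e(1) by blast
  next
    case False
    then obtain v where "v \<in> X" "v \<in> ?en e" unfolding \<kappa>_def by blast
    then show ?thesis using e unfolding T_def by blast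
  qed
  have deg: "card {e \<in> B. v \<in> ?en e} \<le> 2 * f v"
    if "v \<in> X" "\<not> odd_at ?en B v" "{e \<in> B. v \<in> ?en e} \<subseteq> U" for v B
  proof -
    have "card {e \<in> B. v \<in> ?en e} \<le> card {e \<in> U. v \<in> ?en e}"
      using that(3) finU by (intro card_mono) auto
    then have "card {e \<in> B. v \<in> ?en e} \<le> 2 * f v + 1" using U_deg[OF that(1)] by simp
    moreover have "card {e \<in> B. v \<in> ?en e} \<noteq> 2 * f v + 1" using that(2) unfolding odd_at_def by auto
    ultimately show ?thesis by simp
  qed
  show ?thesis
  proof (cases "has_bounded_spanning_closed_trail G T f")
    case True
    obtain Q where Q: "Q \<subseteq> ?E" "connects ?en Q ?V" "\<forall>v. \<not> odd_at ?en Q v"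
        "\<forall>v\<in>T. card {e \<in> Q. v \<in> ?en e} \<le> 2 * f v"
      by (rule has_bounded_spanning_closed_trailE[OF G True])
    have F1_span: "conn ?en A \<subseteq> conn ?en (F 1 \<inter> A)" using span[of 1] by simp
    obtain J where J: "J \<subseteq> F 1 \<inter> A" "\<forall>v. \<not> odd_at ?en ((Q - A) \<union> (F 0 \<inter> A) \<union> J) v"
      by (rule reroute[OF finE card2 Q(1) F01 A F_disj F1_span Q(3)])
    let ?B = "(Q - A) \<union> (F 0 \<inter> A) \<union> J"
    have BE: "?B \<subseteq> ?E" using Q(1) F01 J(1) by blast
    have "conn ?en Q \<subseteq> conn ?en ?B"
    proof (rule conn_replace)
      fix e u v assume e: "e \<in> Q" "?en e = {u, v}"
      show "(u, v) \<in> conn ?en ?B"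
      proof (cases "e \<in> A")
        case True
        then have "(u, v) \<in> conn ?en (F 0 \<inter> A)" using span[of 0] conn_edge[of e A] e(2) by simp
        then show ?thesis using conn_mono[of "F 0 \<inter> A" ?B ?en] by blast
      next
        case False
        then show ?thesis using e by (intro conn_edge[of e]) auto
      qed
    qed
    then have B_conn: "connects ?en ?B ?V" using Q(2) unfolding connects_def by blast
    have B_deg: "card {e \<in> ?B. v \<in> ?en e} \<le> 2 * f v" if v: "v \<in> X" for v
    proof (cases "v \<in> T")
      case True
      then have "{e \<in> ?B. v \<in> ?en e} \<subseteq> {e \<in> Q. v \<in> ?en e}" using T_A[OF True] J(1) by blast
      moreover have "finite Q" using Q(1) finE by (rule finite_subset)
      ultimately have "card {e \<in> ?B. v \<in> ?en e} \<le> card {e \<in> Q. v \<in> ?en e}"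
        by (intro card_mono) auto
      then show ?thesis using bspec[OF Q(4) True] by simp
    next
      case False
      have "e \<in> U" if "e \<in> ?B" "v \<in> ?en e" for e
      proof (cases "e \<in> Q - A")
        case True
        \<comment> \<open>The only end of \<open>e\<close> in \<open>X\<close> is \<open>v\<close>,
          which is not in \<open>T\<close>; hence \<open>T_free\<close> makes this edge of
          \<open>Q\<close> a forest edge.\<close>
        then have "?en e \<inter> T = {}" using one_end[of e v] Q(1) that(2) v TX False by blast
        then show ?thesis using T_free True Q(1) by blast
      next
        case False
        then show ?thesis using that(1) J(1) unfolding U_def by blast
      qed
      then show ?thesis using deg[OF v spec[OF J(2)]] by blast
    qed
    then show ?thesis
      using has_bounded_spanning_closed_trailI[OF G BE V_ne B_conn J(2)] assms(5) by blast
  next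
    case False
    let ?H = "delete_verts G T"
    have H: "verts ?H = ?V - T" "edges ?H = {e \<in> ?E. ?en e \<subseteq> ?V - T}" "ends ?H = ?en"
      unfolding delete_verts_def by simp_all
    have mH: "multigraph ?H" unfolding delete_verts_def by (rule multigraph_induced_subgraph[OF G]) blast
    have AH: "A \<subseteq> edges ?H" unfolding H using A ends T_A by blast
    have inside: "\<exists>W\<subseteq>verts ?H. ends ?H e \<subseteq> W \<and> tree_connected 2 (induced_subgraph ?H W)"
      if e: "e \<in> A" for e
    proof -
      have "card (?en e) = 2" "e \<in> edges ?H" using ends A AH e by blast+
      then have "\<exists>u v. ?en e = {u, v} \<and> u \<in> verts ?H" unfolding H by (auto simp: card_2_iff)
      then obtain u v where uv: "?en e = {u, v}" "u \<in> verts ?H" by blast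
      let ?W = "component (ends ?H) A u"
      have dis: "disjoint_family_on (\<lambda>i. F i \<inter> A) {..<2::nat}"
        using F(2) unfolding disjoint_family_on_def by blast
      have sp: "conn (ends ?H) (F i \<inter> A) = conn (ends ?H) A" if "i < 2" for i
        using span[OF that] unfolding H .
      have "?W \<subseteq> verts ?H"
        by (rule component_tree_connected(1)[OF mH uv(2) AH dis _ sp]) simp_all
      moreover have "tree_connected 2 (induced_subgraph ?H ?W)"
        by (rule component_tree_connected(2)[OF mH uv(2) AH dis _ sp]) simp_all
      moreover have "?en e \<subseteq> ?W"
        using conn_edge[where en = "ends G", OF e uv(1)] unfolding uv(1) component_def H by simp
      ultimately show ?thesis unfolding H by blast
    qed
    \<comment> \<open>\<open>?r\<close> is taken over all of \<open>?V\<close>, including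
      \<open>T\<close>, so that \<open>?r A\<close> is the same number that enters the ranks of
      \<open>F 0\<close> and \<open>F 1\<close>.\<close>
    have bound: "int 2 * int (card (?V - T))
        \<le> Omega 2 ?H + int 2 * int (?r A) + int (card (edges ?H - A))"
      using Omega_rank_bound[OF mH finV _ AH inside] unfolding H by simp
    have "(1 / 2) * real_of_int (Omega 2 ?H) \<le> (\<Sum>v\<in>T. (real (f v) - 1 / 2)) + 1"
      using assms(6) TX False by blast
    also have "(\<Sum>v\<in>T. (real (f v) - 1 / 2)) = real (\<Sum>v\<in>T. f v) - real (card T) / 2"
      by (simp add: sum_subtractf)
    finally have "real_of_int (Omega 2 ?H) + real (card T) \<le> 2 * real (\<Sum>v\<in>T. f v) + 2" by simp
    then have Omega: "Omega 2 ?H + int (card T) \<le> 2 * int (\<Sum>v\<in>T. f v) + 2" by linarith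
    have "T \<subseteq> ?V" using TX assms(3) by blast
    then have cardV: "card ?V = card (?V - T) + card T"
      using finV finT by (simp add: card_Diff_subset card_mono)
    \<comment> \<open>Edges of \<open>?H\<close> outside \<open>A\<close> avoid \<open>T\<close> and
      so belong to \<open>U\<close>. The stars at \<open>T\<close> are counted separately, disjoint
      from these and, by independence, from each other.\<close>
    have stars: "(edges ?H - A) \<union> (\<Union>v\<in>T. {e \<in> U - A. v \<in> ?en e}) \<subseteq> U - A"
      using T_free unfolding H by blast
    have "card (edges ?H - A) + (\<Sum>v\<in>T. 2 * f v + 1)
        = card (edges ?H - A) + (\<Sum>v\<in>T. card {e \<in> U - A. v \<in> ?en e})"
      using T_out by simp
    also have "(\<Sum>v\<in>T. card {e \<in> U - A. v \<in> ?en e}) = card (\<Union>v\<in>T. {e \<in> U - A. v \<in> ?en e})"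
    proof (rule card_UN_disjoint[symmetric, OF finT])
      show "\<forall>v\<in>T. finite {e \<in> U - A. v \<in> ?en e}" using finU by simp
      show "\<forall>u\<in>T. \<forall>v\<in>T. u \<noteq> v \<longrightarrow> {e \<in> U - A. u \<in> ?en e} \<inter> {e \<in> U - A. v \<in> ?en e} = {}"
        using one_end UE TX by blast
    qed
    also have "card (edges ?H - A) + card (\<Union>v\<in>T. {e \<in> U - A. v \<in> ?en e})
        = card ((edges ?H - A) \<union> (\<Union>v\<in>T. {e \<in> U - A. v \<in> ?en e}))"
    proof (rule card_Un_disjoint[symmetric])
      show "finite (edges ?H - A)" unfolding H using finE by simp
      show "finite (\<Union>v\<in>T. {e \<in> U - A. v \<in> ?en e})" using finT finU by simp
      show "(edges ?H - A) \<inter> (\<Union>v\<in>T. {e \<in> U - A. v \<in> ?en e}) = {}" unfolding H by blast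
    qed
    also have "\<dots> \<le> card (U - A)" using stars finU by (intro card_mono) auto
    finally have out: "card (edges ?H - A) + (\<Sum>v\<in>T. 2 * f v + 1) \<le> card (U - A)" .
    have sum2: "(\<Sum>v\<in>T. 2 * f v + 1) = 2 * (\<Sum>v\<in>T. f v) + card T"
      by (simp only: sum.distrib sum_distrib_left card_eq_sum)
    have finF: "finite (F i)" if "i < 2" for i using F_E[OF that] finE by (rule finite_subset)
    have split: "?r (F i) = ?r A + card (F i - A)" if i: "i < 2" for i
    proof -
      have "?r (F i \<inter> A) = card (F i \<inter> A)"
        by (rule rank_function_independent_subset[OF r F_E[OF i] F_ind[OF i]]) blast
      moreover have "card (F i) = card (F i \<inter> A) + card (F i - A)"
        using finF[OF i] by (metis card_Int_Diff)
      ultimately show ?thesis using F_ind[OF i] F_A[OF i] by simp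
    qed
    have "U - A = (F 0 - A) \<union> (F 1 - A)" unfolding U_def by blast
    then have "card (U - A) = card (F 0 - A) + card (F 1 - A)"
      using finF[of 0] finF[of 1] F_disj by (simp only:) (intro card_Un_disjoint, auto)
    moreover have "Suc (?r (F 0)) \<le> card ?V" "Suc (?r (F 1)) \<le> card ?V"
      using graphic_rank_le[OF finV V_ne] by blast+
    \<comment> \<open>With n = \<open>card ?V\<close> and t = \<open>card T\<close>, the facts
      \<open>bound\<close>, \<open>Omega\<close> and \<open>out\<close> add up to 2 n - 2 t <= 2 - 2
      t + \<open>2 * ?r A + card (U - A)\<close>. By \<open>split\<close> the two forest ranks sum
      to at least 2 n - 2, and neither exceeds n - 1.\<close>
    ultimately have full: "card ?V \<le> Suc (?r (F 0))" "card ?V \<le> Suc (?r (F 1))"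
      using bound Omega cardV out sum2 split[of 0] split[of 1] by linarith+
    have tree: "(u, v) \<in> conn ?en (F i)" if "i = 0 \<or> i = 1" "u \<in> ?V" "v \<in> ?V" for i u v
      using conn_of_graphic_rank_full[OF finV _ that(2,3)] full that(1) by blast
    have F1_span: "conn ?en ?E \<subseteq> conn ?en (F 1 \<inter> ?E)"
    proof (rule conn_replace)
      fix e u v assume "e \<in> ?E" "?en e = {u, v}"
      then have "u \<in> ?V" "v \<in> ?V" using ends[of e] by auto
      then show "(u, v) \<in> conn ?en (F 1 \<inter> ?E)" using tree[of 1] F01(2) by (simp add: Int_absorb2)
    qed
    have empty_even: "\<forall>v. \<not> odd_at ?en {} v" by (simp add: odd_at_def)
    obtain J where J: "J \<subseteq> F 1 \<inter> ?E"
        "\<forall>v. \<not> odd_at ?en (({} - ?E) \<union> (F 0 \<inter> ?E) \<union> J) v"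
      by (rule reroute[OF finE card2 empty_subsetI F01 subset_refl F_disj F1_span empty_even])
    let ?B = "F 0 \<union> J"
    have BE: "?B \<subseteq> ?E" using F01 J(1) by blast
    have "({} - ?E) \<union> (F 0 \<inter> ?E) \<union> J = ?B" using F01(1) by blast
    then have even: "\<forall>v. \<not> odd_at ?en ?B v" using J(2) by simp
    have "card {e \<in> ?B. v \<in> ?en e} \<le> 2 * f v" if "v \<in> X" for v
      by (rule deg[OF that spec[OF even]]) (use J(1) in \<open>auto simp: U_def\<close>)
    moreover have "conn ?en (F 0) \<subseteq> conn ?en ?B" by (rule conn_mono) blast
    then have "connects ?en ?B ?V" using tree[of 0] unfolding connects_def by blast
    ultimately show ?thesis
      using has_bounded_spanning_closed_trailI[OF G BE V_ne _ even] assms(5) by blast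
  qed
qed

end
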